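(* Let $(\mathcal{V},\bullet,\mathbf{I};\omega)$ be a semiunital semimonoidal category and let $\mathbb{J}:=\mathbf{I}\bullet-\simeq-\bullet\mathbf{I}:\mathcal{V}\to\mathcal{V}$. Assume that $\mathcal{V}$ is cocomplete, that $\mathbf{I}$ and $C\in\mathcal{V}$ are firm, that $\mathbf{I}$ is a regular generator in $\mathcal{V}$, and that both functors $C\bullet-$ and $-\bullet C:\mathcal{V}\to\mathcal{V}$ preserve colimits. Then there is a bijective correspondence between: the $\mathcal{V}$-semicomonoid structures $(C,\Delta,\varepsilon)$ on $C$; the $\mathbb{J}$-comonad structures $(-\bullet C,\boldsymbol{\Delta},\omega,\boldsymbol{\theta};\mathbb{J})$ on the endofunctor $-\bullet C$; and the $\mathbb{J}$-comonad structures $(C\bullet-,\boldsymbol{\Delta},\omega,\boldsymbol{\theta};\mathbb{J})$ on the endofunctor $C\bullet-$.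
   Context: A semimonoidal category $(\mathcal{V},\bullet)$ is a category with a bifunctor $\bullet$ and natural associativity isomorphisms $\gamma_{X,Y,Z}:(X\bullet Y)\bullet Z\to X\bullet(Y\bullet Z)$ satisfying the pentagon axiom (a monoidal category without a unit). Objects are also used to denote their identity morphisms, and associativity isomorphisms are suppressed where harmless. An object $\mathbf{I}$ is a semiunit, and $(\mathcal{V},\bullet,\mathbf{I};\omega)$ is called semiunital semimonoidal, if there are: a natural transformation $\omega_X:X\to\mathbf{I}\bullet X$; and a natural isomorphism $\ell_X:\mathbf{I}\bullet X\to X\bullet\mathbf{I}$ with inverse $\wp_X$ such that $\ell_{\mathbf{I}}=\wp_{\mathbf{I}}$ and, for all $X,Y$, $$\gamma_{X,Y,\mathbf{I}}\circ\ell_{X\bullet Y}\circ\gamma_{\mathbf{I},X,Y}=(X\bullet\ell_Y)\circ\gamma_{X,\mathbf{I},Y}\circ(\ell_X\bullet Y),$$ $$\omega_{X\bullet Y}=\gamma_{\mathbf{I},X,Y}\circ(\omega_X\bullet Y)=\gamma_{\mathbf{I},X,Y}\circ(\wp_X\bullet Y)\circ\gamma_{X,\mathbf{I},Y}^{-1}\circ(X\bullet\omega_Y).$$ These data are fixed. An object $X$ is firm if $\omega_X$ is an isomorphism. A $\mathcal{V}$-semicomonoid structure on $C$ is a pair of morphisms $\Delta:C\to C\bullet C$, $\varepsilon:C\to\mathbf{I}$ with $(\Delta\bullet C)\circ\Delta=(C\bullet\Delta)\circ\Delta$, $(\varepsilon\bullet C)\circ\Delta=\omega_C$ and $(C\bullet\varepsilon)\circ\Delta=\ell_C\circ\omega_C$.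 A $\mathbb{J}$-comonad $(\mathbb{C},\boldsymbol{\Delta},\omega,\boldsymbol{\theta};\mathbb{J})$, for an endofunctor $\mathbb{J}$, consists of an endofunctor $\mathbb{C}$ and natural transformations $\boldsymbol{\Delta}:\mathbb{C}\to\mathbb{C}\mathbb{C}$, $\omega:\mathrm{Id}\to\mathbb{J}$, $\boldsymbol{\theta}:\mathbb{C}\to\mathbb{J}$ with, for all $X$, $\boldsymbol{\Delta}_{\mathbb{C}(X)}\circ\boldsymbol{\Delta}_X=\mathbb{C}(\boldsymbol{\Delta}_X)\circ\boldsymbol{\Delta}_X$, $\boldsymbol{\theta}_{\mathbb{C}(X)}\circ\boldsymbol{\Delta}_X=\omega_{\mathbb{C}(X)}$ and $\mathbb{C}(\boldsymbol{\theta}_X)\circ\boldsymbol{\Delta}_X=\mathbb{C}(\omega_X)$. In the claim, $\omega$ is always the fixed natural transformation belonging to the semiunit $\mathbf{I}$. An object $G$ of a cocomplete category is a regular generator if for every object $X$ the canonical morphism $\coprod_{f\in\mathrm{Hom}(G,X)}G\to X$ is a regular epimorphism (a coequalizer). *)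

theory Defs
  imports "HOL-Library.FuncSet" "HOL-Library.Equipollence"
begin

section \<open>Categories, functors, natural transformations\<close>

record ('o, 'a) cat =
  ob :: "'o set"
  ar :: "'a set"
  src :: "'a \<Rightarrow> 'o"
  tgt :: "'a \<Rightarrow> 'o"
  idt :: "'o \<Rightarrow> 'a"
  cmp :: "'a \<Rightarrow> 'a \<Rightarrow> 'a" (infixr "\<cdot>\<index>" 60)

definition hom :: "('o, 'a, 'm) cat_scheme \<Rightarrow> 'o \<Rightarrow> 'o \<Rightarrow> 'a set" where
  "hom V X Y = {f \<in> ar V. src V f = X \<and> tgt V f = Y}"

locale category =
  fixes V :: "('o, 'a, 'm) cat_scheme" (structure)
  assumes src_ob: "f \<in> ar V \<Longrightarrow> src V f \<in> ob V"
    and tgt_ob: "f \<in> ar V \<Longrightarrow> tgt V f \<in> ob V"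
    and idt_hom: "X \<in> ob V \<Longrightarrow> idt V X \<in> hom V X X"
    and cmp_hom: "f \<in> hom V X Y \<Longrightarrow> g \<in> hom V Y Z \<Longrightarrow> g \<cdot> f \<in> hom V X Z"
    and cmp_idt_left: "f \<in> hom V X Y \<Longrightarrow> idt V Y \<cdot> f = f"
    and cmp_idt_right: "f \<in> hom V X Y \<Longrightarrow> f \<cdot> idt V X = f"
    and cmp_assoc: "f \<in> hom V W X \<Longrightarrow> g \<in> hom V X Y \<Longrightarrow> h \<in> hom V Y Z
      \<Longrightarrow> (h \<cdot> g) \<cdot> f = h \<cdot> (g \<cdot> f)"

definition inverse_arrows :: "('o, 'a, 'm) cat_scheme \<Rightarrow> 'a \<Rightarrow> 'a \<Rightarrow> bool" where
  "inverse_arrows V f g \<longleftrightarrow> f \<in> ar V \<and> g \<in> hom V (tgt V f) (src V f) \<and>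
     g \<cdot>\<^bsub>V\<^esub> f = idt V (src V f) \<and> f \<cdot>\<^bsub>V\<^esub> g = idt V (tgt V f)"

definition is_iso :: "('o, 'a, 'm) cat_scheme \<Rightarrow> 'a \<Rightarrow> bool" where
  "is_iso V f \<longleftrightarrow> (\<exists>g. inverse_arrows V f g)"

definition inv_ar :: "('o, 'a, 'm) cat_scheme \<Rightarrow> 'a \<Rightarrow> 'a" where
  "inv_ar V f = (THE g. inverse_arrows V f g)"

record ('o, 'a, 'p, 'b) functr =
  fo :: "'o \<Rightarrow> 'p"
  fa :: "'a \<Rightarrow> 'b"

definition is_functor ::
    "('o, 'a, 'm) cat_scheme \<Rightarrow> ('p, 'b, 'n) cat_scheme \<Rightarrow> ('o, 'a, 'p, 'b) functr \<Rightarrow> bool" where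
  "is_functor A B F \<longleftrightarrow>
     (\<forall>X \<in> ob A. fo F X \<in> ob B) \<and>
     (\<forall>f \<in> ar A. fa F f \<in> hom B (fo F (src A f)) (fo F (tgt A f))) \<and>
     (\<forall>X \<in> ob A. fa F (idt A X) = idt B (fo F X)) \<and>
     (\<forall>f \<in> ar A. \<forall>g \<in> ar A. src A g = tgt A f \<longrightarrow>
        fa F (g \<cdot>\<^bsub>A\<^esub> f) = fa F g \<cdot>\<^bsub>B\<^esub> fa F f)"

definition id_functor :: "('o, 'a, 'o, 'a) functr" where
  "id_functor = \<lparr>fo = (\<lambda>X. X), fa = (\<lambda>f. f)\<rparr>"

definition comp_functor ::
    "('p, 'b, 'q, 'c) functr \<Rightarrow> ('o, 'a, 'p, 'b) functr \<Rightarrow> ('o, 'a, 'q, 'c) functr" where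
  "comp_functor G F = \<lparr>fo = (\<lambda>X. fo G (fo F X)), fa = (\<lambda>f. fa G (fa F f))\<rparr>"

definition nat_trans ::
    "('o, 'a, 'm) cat_scheme \<Rightarrow> ('p, 'b, 'n) cat_scheme \<Rightarrow>
     ('o, 'a, 'p, 'b) functr \<Rightarrow> ('o, 'a, 'p, 'b) functr \<Rightarrow> ('o \<Rightarrow> 'b) \<Rightarrow> bool" where
  "nat_trans A B F G \<tau> \<longleftrightarrow>
     (\<forall>X \<in> ob A. \<tau> X \<in> hom B (fo F X) (fo G X)) \<and>
     (\<forall>f \<in> ar A. \<tau> (tgt A f) \<cdot>\<^bsub>B\<^esub> fa F f = fa G f \<cdot>\<^bsub>B\<^esub> \<tau> (src A f))"


section \<open>Colimits\<close>

definition is_cocone ::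
    "('j, 'k, 'n) cat_scheme \<Rightarrow> ('o, 'a, 'm) cat_scheme \<Rightarrow> ('j, 'k, 'o, 'a) functr \<Rightarrow>
     'o \<Rightarrow> ('j \<Rightarrow> 'a) \<Rightarrow> bool" where
  "is_cocone J V D X \<iota> \<longleftrightarrow> X \<in> ob V \<and>
     (\<forall>j \<in> ob J. \<iota> j \<in> hom V (fo D j) X) \<and>
     (\<forall>u \<in> ar J. \<iota> (tgt J u) \<cdot>\<^bsub>V\<^esub> fa D u = \<iota> (src J u))"

definition is_colimit ::
    "('j, 'k, 'n) cat_scheme \<Rightarrow> ('o, 'a, 'm) cat_scheme \<Rightarrow> ('j, 'k, 'o, 'a) functr \<Rightarrow>
     'o \<Rightarrow> ('j \<Rightarrow> 'a) \<Rightarrow> bool" where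
  "is_colimit J V D X \<iota> \<longleftrightarrow> is_cocone J V D X \<iota> \<and>
     (\<forall>Y \<kappa>. is_cocone J V D Y \<kappa> \<longrightarrow>
        (\<exists>!h. h \<in> hom V X Y \<and> (\<forall>j \<in> ob J. h \<cdot>\<^bsub>V\<^esub> \<iota> j = \<kappa> j)))"

text \<open>
  Size is measured by an infinite type \<open>'u\<close>: a set is small if it has strictly smaller cardinality
  than \<open>'u\<close>. If the cardinality of \<open>'u\<close> is inaccessible, these are, up to bijection, the members of
  a Grothendieck universe; for \<open>'u = nat\<close> they are the finite sets. Without a size restriction of
  this kind, a category with all coproducts indexed by sets of its own arrows is a preorder.

  Every small category is isomorphic to one whose objects and arrows are elements of \<open>'u\<close>, so the
  shapes of small diagrams may be taken of type \<open>('u, 'u) cat\<close>. The set of objects of a category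
  injects into its set of arrows, so only the latter needs to be bounded.
\<close>

definition small :: "'u itself \<Rightarrow> 'x set \<Rightarrow> bool" where
  "small U A \<longleftrightarrow> A \<prec> (UNIV :: 'u set)"

definition small_category :: "('u, 'u) cat \<Rightarrow> bool" where
  "small_category J \<longleftrightarrow> category J \<and> small TYPE('u) (ar J)"

definition locally_small :: "'u itself \<Rightarrow> ('o, 'a, 'm) cat_scheme \<Rightarrow> bool" where
  "locally_small U V \<longleftrightarrow> (\<forall>X \<in> ob V. \<forall>Y \<in> ob V. small U (hom V X Y))"

definition cocomplete :: "'u itself \<Rightarrow> ('o, 'a, 'm) cat_scheme \<Rightarrow> bool" where
  "cocomplete U V \<longleftrightarrow>
     (\<forall>(J :: ('u, 'u) cat) D. small_category J \<and> is_functor J V D \<longrightarrow>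
        (\<exists>X \<iota>. is_colimit J V D X \<iota>))"

definition preserves_colimits ::
    "'u itself \<Rightarrow> ('o, 'a, 'm) cat_scheme \<Rightarrow> ('p, 'b, 'n) cat_scheme \<Rightarrow>
     ('o, 'a, 'p, 'b) functr \<Rightarrow> bool" where
  "preserves_colimits U V W F \<longleftrightarrow>
     (\<forall>(J :: ('u, 'u) cat) D X \<iota>. small_category J \<and> is_functor J V D \<and> is_colimit J V D X \<iota> \<longrightarrow>
        is_colimit J W (comp_functor F D) (fo F X) (\<lambda>j. fa F (\<iota> j)))"

definition discrete_cat :: "'j set \<Rightarrow> ('j, 'j) cat" where
  "discrete_cat S =
     \<lparr>ob = S, ar = S, src = (\<lambda>j. j), tgt = (\<lambda>j. j), idt = (\<lambda>j. j), cmp = (\<lambda>j k. j)\<rparr>"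

definition is_coproduct ::
    "('o, 'a, 'm) cat_scheme \<Rightarrow> 'j set \<Rightarrow> ('j \<Rightarrow> 'o) \<Rightarrow> 'o \<Rightarrow> ('j \<Rightarrow> 'a) \<Rightarrow> bool" where
  "is_coproduct V S D X \<iota> \<longleftrightarrow>
     is_colimit (discrete_cat S) V \<lparr>fo = D, fa = (\<lambda>j. idt V (D j))\<rparr> X \<iota>"

definition is_coequalizer :: "('o, 'a, 'm) cat_scheme \<Rightarrow> 'a \<Rightarrow> 'a \<Rightarrow> 'a \<Rightarrow> bool" where
  "is_coequalizer V p q e \<longleftrightarrow>
     (\<exists>A B Q. p \<in> hom V A B \<and> q \<in> hom V A B \<and> e \<in> hom V B Q \<and>
        e \<cdot>\<^bsub>V\<^esub> p = e \<cdot>\<^bsub>V\<^esub> q \<and>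
        (\<forall>Y. \<forall>h \<in> hom V B Y. h \<cdot>\<^bsub>V\<^esub> p = h \<cdot>\<^bsub>V\<^esub> q \<longrightarrow>
           (\<exists>!k. k \<in> hom V Q Y \<and> k \<cdot>\<^bsub>V\<^esub> e = h)))"

definition regular_epi :: "('o, 'a, 'm) cat_scheme \<Rightarrow> 'a \<Rightarrow> bool" where
  "regular_epi V e \<longleftrightarrow> (\<exists>p q. is_coequalizer V p q e)"

definition regular_generator :: "('o, 'a, 'm) cat_scheme \<Rightarrow> 'o \<Rightarrow> bool" where
  "regular_generator V G \<longleftrightarrow> G \<in> ob V \<and>
     (\<forall>X \<in> ob V. \<exists>S \<iota> e. is_coproduct V (hom V G X) (\<lambda>_. G) S \<iota> \<and>
        e \<in> hom V S X \<and> (\<forall>f \<in> hom V G X. e \<cdot>\<^bsub>V\<^esub> \<iota> f = f) \<and> regular_epi V e)"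


section \<open>Semiunital semimonoidal categories\<close>

record ('o, 'a) semimonoidal_cat = "('o, 'a) cat" +
  tensor_ob :: "'o \<Rightarrow> 'o \<Rightarrow> 'o" (infixl "\<bullet>\<index>" 70)
  tensor_ar :: "'a \<Rightarrow> 'a \<Rightarrow> 'a" (infixl "\<otimes>\<index>" 70)
  assoc :: "'o \<Rightarrow> 'o \<Rightarrow> 'o \<Rightarrow> 'a" ("\<gamma>\<index>")

locale semimonoidal = category V
  for V :: "('o, 'a, 'm) semimonoidal_cat_scheme" (structure) +
  assumes tensor_ob: "X \<in> ob V \<Longrightarrow> Y \<in> ob V \<Longrightarrow> X \<bullet> Y \<in> ob V"
    and tensor_hom: "f \<in> hom V X X' \<Longrightarrow> g \<in> hom V Y Y' \<Longrightarrow> f \<otimes> g \<in> hom V (X \<bullet> Y) (X' \<bullet> Y')"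
    and tensor_idt: "X \<in> ob V \<Longrightarrow> Y \<in> ob V \<Longrightarrow> idt V X \<otimes> idt V Y = idt V (X \<bullet> Y)"
    and tensor_cmp: "f \<in> hom V X X' \<Longrightarrow> f' \<in> hom V X' X'' \<Longrightarrow>
      g \<in> hom V Y Y' \<Longrightarrow> g' \<in> hom V Y' Y'' \<Longrightarrow>
      (f' \<cdot> f) \<otimes> (g' \<cdot> g) = (f' \<otimes> g') \<cdot> (f \<otimes> g)"
    and assoc_hom: "X \<in> ob V \<Longrightarrow> Y \<in> ob V \<Longrightarrow> Z \<in> ob V \<Longrightarrow>
      \<gamma> X Y Z \<in> hom V ((X \<bullet> Y) \<bullet> Z) (X \<bullet> (Y \<bullet> Z))"
    and assoc_iso: "X \<in> ob V \<Longrightarrow> Y \<in> ob V \<Longrightarrow> Z \<in> ob V \<Longrightarrow> is_iso V (\<gamma> X Y Z)"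
    and assoc_nat: "f \<in> hom V X X' \<Longrightarrow> g \<in> hom V Y Y' \<Longrightarrow> h \<in> hom V Z Z' \<Longrightarrow>
      \<gamma> X' Y' Z' \<cdot> ((f \<otimes> g) \<otimes> h) = (f \<otimes> (g \<otimes> h)) \<cdot> \<gamma> X Y Z"
    and pentagon: "W \<in> ob V \<Longrightarrow> X \<in> ob V \<Longrightarrow> Y \<in> ob V \<Longrightarrow> Z \<in> ob V \<Longrightarrow>
      \<gamma> W X (Y \<bullet> Z) \<cdot> \<gamma> (W \<bullet> X) Y Z =
      (idt V W \<otimes> \<gamma> X Y Z) \<cdot> \<gamma> W (X \<bullet> Y) Z \<cdot> (\<gamma> W X Y \<otimes> idt V Z)"

definition tensor_left :: "('o, 'a, 'm) semimonoidal_cat_scheme \<Rightarrow> 'o \<Rightarrow> ('o, 'a, 'o, 'a) functr"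
  where "tensor_left V C = \<lparr>fo = (\<lambda>X. C \<bullet>\<^bsub>V\<^esub> X), fa = (\<lambda>f. idt V C \<otimes>\<^bsub>V\<^esub> f)\<rparr>"

definition tensor_right :: "('o, 'a, 'm) semimonoidal_cat_scheme \<Rightarrow> 'o \<Rightarrow> ('o, 'a, 'o, 'a) functr"
  where "tensor_right V C = \<lparr>fo = (\<lambda>X. X \<bullet>\<^bsub>V\<^esub> C), fa = (\<lambda>f. f \<otimes>\<^bsub>V\<^esub> idt V C)\<rparr>"

record ('o, 'a) semiunital_cat = "('o, 'a) semimonoidal_cat" +
  semiunit :: 'o ("\<I>\<index>")
  omega :: "'o \<Rightarrow> 'a" ("\<omega>\<index>")
  ell :: "'o \<Rightarrow> 'a" ("\<l>\<index>")

definition wp :: "('o, 'a, 'm) semiunital_cat_scheme \<Rightarrow> 'o \<Rightarrow> 'a" ("\<wp>\<index>") where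
  "wp V X = inv_ar V (\<l>\<^bsub>V\<^esub> X)"

locale semiunital_semimonoidal = semimonoidal V
  for V :: "('o, 'a, 'm) semiunital_cat_scheme" (structure) +
  assumes semiunit_ob: "\<I> \<in> ob V"
    and omega_nat: "nat_trans V V id_functor (tensor_left V \<I>) \<omega>"
    and ell_nat: "nat_trans V V (tensor_left V \<I>) (tensor_right V \<I>) \<l>"
    and ell_iso: "X \<in> ob V \<Longrightarrow> is_iso V (\<l> X)"
    and ell_semiunit: "\<l> \<I> = \<wp> \<I>"
    and ell_tensor: "X \<in> ob V \<Longrightarrow> Y \<in> ob V \<Longrightarrow>
      \<gamma> X Y \<I> \<cdot> \<l> (X \<bullet> Y) \<cdot> \<gamma> \<I> X Y =
      (idt V X \<otimes> \<l> Y) \<cdot> \<gamma> X \<I> Y \<cdot> (\<l> X \<otimes> idt V Y)"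
    and omega_tensor_left: "X \<in> ob V \<Longrightarrow> Y \<in> ob V \<Longrightarrow>
      \<omega> (X \<bullet> Y) = \<gamma> \<I> X Y \<cdot> (\<omega> X \<otimes> idt V Y)"
    and omega_tensor_right: "X \<in> ob V \<Longrightarrow> Y \<in> ob V \<Longrightarrow>
      \<omega> (X \<bullet> Y) =
      \<gamma> \<I> X Y \<cdot> (\<wp> X \<otimes> idt V Y) \<cdot> inv_ar V (\<gamma> X \<I> Y) \<cdot> (idt V X \<otimes> \<omega> Y)"

definition firm :: "('o, 'a, 'm) semiunital_cat_scheme \<Rightarrow> 'o \<Rightarrow> bool" where
  "firm V X \<longleftrightarrow> X \<in> ob V \<and> is_iso V (\<omega>\<^bsub>V\<^esub> X)"


section \<open>Semicomonoids and comonads relative to an endofunctor\<close>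

definition is_semicomonoid :: "('o, 'a, 'm) semiunital_cat_scheme \<Rightarrow> 'o \<Rightarrow> 'a \<Rightarrow> 'a \<Rightarrow> bool" where
  "is_semicomonoid V C \<Delta> \<epsilon> \<longleftrightarrow>
     \<Delta> \<in> hom V C (C \<bullet>\<^bsub>V\<^esub> C) \<and> \<epsilon> \<in> hom V C \<I>\<^bsub>V\<^esub> \<and>
     \<gamma>\<^bsub>V\<^esub> C C C \<cdot>\<^bsub>V\<^esub> (\<Delta> \<otimes>\<^bsub>V\<^esub> idt V C) \<cdot>\<^bsub>V\<^esub> \<Delta> = (idt V C \<otimes>\<^bsub>V\<^esub> \<Delta>) \<cdot>\<^bsub>V\<^esub> \<Delta> \<and>
     (\<epsilon> \<otimes>\<^bsub>V\<^esub> idt V C) \<cdot>\<^bsub>V\<^esub> \<Delta> = \<omega>\<^bsub>V\<^esub> C \<and>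
     (idt V C \<otimes>\<^bsub>V\<^esub> \<epsilon>) \<cdot>\<^bsub>V\<^esub> \<Delta> = \<l>\<^bsub>V\<^esub> C \<cdot>\<^bsub>V\<^esub> \<omega>\<^bsub>V\<^esub> C"

definition semicomonoid_structures ::
    "('o, 'a, 'm) semiunital_cat_scheme \<Rightarrow> 'o \<Rightarrow> ('a \<times> 'a) set" where
  "semicomonoid_structures V C = {(\<Delta>, \<epsilon>). is_semicomonoid V C \<Delta> \<epsilon>}"

definition is_J_comonad ::
    "('o, 'a, 'm) cat_scheme \<Rightarrow> ('o, 'a, 'o, 'a) functr \<Rightarrow> ('o, 'a, 'o, 'a) functr \<Rightarrow>
     ('o \<Rightarrow> 'a) \<Rightarrow> ('o \<Rightarrow> 'a) \<Rightarrow> ('o \<Rightarrow> 'a) \<Rightarrow> bool" where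
  "is_J_comonad V J F \<Delta> w \<theta> \<longleftrightarrow>
     is_functor V V J \<and> is_functor V V F \<and>
     nat_trans V V F (comp_functor F F) \<Delta> \<and>
     nat_trans V V id_functor J w \<and>
     nat_trans V V F J \<theta> \<and>
     (\<forall>X \<in> ob V.
        \<Delta> (fo F X) \<cdot>\<^bsub>V\<^esub> \<Delta> X = fa F (\<Delta> X) \<cdot>\<^bsub>V\<^esub> \<Delta> X \<and>
        \<theta> (fo F X) \<cdot>\<^bsub>V\<^esub> \<Delta> X = w (fo F X) \<and>
        fa F (\<theta> X) \<cdot>\<^bsub>V\<^esub> \<Delta> X = fa F (w X))"

text \<open>
  Families of arrows are made extensional on the objects, so that equality of HOL functions is
  equality of natural transformations.
\<close>

definition J_comonad_structures ::
    "('o, 'a, 'm) cat_scheme \<Rightarrow> ('o, 'a, 'o, 'a) functr \<Rightarrow> ('o, 'a, 'o, 'a) functr \<Rightarrow>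
     ('o \<Rightarrow> 'a) \<Rightarrow> (('o \<Rightarrow> 'a) \<times> ('o \<Rightarrow> 'a)) set" where
  "J_comonad_structures V J F w =
     {(\<Delta>, \<theta>). \<Delta> \<in> extensional (ob V) \<and> \<theta> \<in> extensional (ob V) \<and> is_J_comonad V J F \<Delta> w \<theta>}"

text \<open>
  The correspondences are \<open>\<Delta> \<mapsto> - \<bullet> \<Delta>\<close>, \<open>\<epsilon> \<mapsto> - \<bullet> \<epsilon>\<close> and \<open>\<Delta> \<mapsto> \<Delta> \<bullet> -\<close>, \<open>\<epsilon> \<mapsto> \<epsilon> \<bullet> -\<close>, with the
  associativity isomorphisms written out. Since the functor \<open>\<I> \<bullet> -\<close> is used for \<open>\<J>\<close>, the arrows
  \<open>X \<bullet> \<epsilon> : X \<bullet> C \<rightarrow> X \<bullet> \<I>\<close> are composed with \<open>\<wp> X : X \<bullet> \<I> \<rightarrow> \<I> \<bullet> X\<close>.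
\<close>

definition right_comonad_of ::
    "('o, 'a, 'm) semiunital_cat_scheme \<Rightarrow> 'o \<Rightarrow> 'a \<times> 'a \<Rightarrow> ('o \<Rightarrow> 'a) \<times> ('o \<Rightarrow> 'a)" where
  "right_comonad_of V C = (\<lambda>(\<Delta>, \<epsilon>).
     (\<lambda>X \<in> ob V. inv_ar V (\<gamma>\<^bsub>V\<^esub> X C C) \<cdot>\<^bsub>V\<^esub> (idt V X \<otimes>\<^bsub>V\<^esub> \<Delta>),
      \<lambda>X \<in> ob V. \<wp>\<^bsub>V\<^esub> X \<cdot>\<^bsub>V\<^esub> (idt V X \<otimes>\<^bsub>V\<^esub> \<epsilon>)))"

definition left_comonad_of ::
    "('o, 'a, 'm) semiunital_cat_scheme \<Rightarrow> 'o \<Rightarrow> 'a \<times> 'a \<Rightarrow> ('o \<Rightarrow> 'a) \<times> ('o \<Rightarrow> 'a)" where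
  "left_comonad_of V C = (\<lambda>(\<Delta>, \<epsilon>).
     (\<lambda>X \<in> ob V. \<gamma>\<^bsub>V\<^esub> C C X \<cdot>\<^bsub>V\<^esub> (\<Delta> \<otimes>\<^bsub>V\<^esub> idt V X),
      \<lambda>X \<in> ob V. \<epsilon> \<otimes>\<^bsub>V\<^esub> idt V X))"

end

theory Submission
  imports Defs
begin

text \<open>
  Consider the functor \<open>C \<bullet> -\<close>. A semicomonoid structure \<open>(\<Delta>, \<epsilon>)\<close> induces the families
  \<open>\<gamma> C C X \<cdot> (\<Delta> \<bullet> X)\<close> and \<open>\<epsilon> \<bullet> X\<close>. By the pentagon, by naturality of \<open>\<gamma>\<close> and by a triangle identity,
  each comonad law for these families at \<open>X\<close> is the corresponding semicomonoid law tensored with \<open>X\<close>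
  (\<open>left_coassoc_iff\<close>, \<open>left_counit_omega_iff\<close>, \<open>left_counit_rho_iff\<close>). So semicomonoids give comonads.

  For the way back everything is read off at the object \<open>\<I>\<close>. Put \<open>\<rho> X = \<l> X \<cdot> \<omega> X : X \<rightarrow> X \<bullet> \<I>\<close>. It is
  natural, satisfies \<open>\<gamma> X Y \<I> \<cdot> \<rho> (X \<bullet> Y) = X \<bullet> \<rho> Y\<close>, and is an isomorphism at firm objects and at
  tensor products whose last factor is firm. Hence \<open>f \<bullet> \<I> = g \<bullet> \<I>\<close> implies \<open>f = g\<close> whenever \<open>\<rho>\<close> is
  invertible at the common target (\<open>tensor_semiunit_cancel\<close>). This applies to all arrows that occur in
  the semicomonoid laws, so the comonad laws at \<open>\<I>\<close> imply the semicomonoid laws, and \<open>(\<Delta>, \<epsilon>)\<close> is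
  determined by the induced families. For the second counit law and for \<open>\<epsilon>\<close> one also needs \<open>\<rho>\<close> at \<open>\<I>\<close>;
  there it coincides with \<open>\<omega>\<close> (\<open>rho_semiunit\<close>).

  Conversely, every pair of arrows \<open>C \<bullet> \<I> \<rightarrow> C \<bullet> (C \<bullet> \<I>)\<close> and \<open>C \<bullet> \<I> \<rightarrow> \<I> \<bullet> \<I>\<close> is induced by some
  \<open>(\<Delta>, \<epsilon>)\<close>, by conjugation with \<open>\<rho>\<close> (\<open>left_families_from_semiunit\<close>). The resulting families agree with
  a given comonad structure at \<open>\<I>\<close>. They agree everywhere, because two natural transformations out of
  a functor that preserves colimits are equal if they are equal at a regular generator
  (\<open>nat_trans_eq_if_eq_at_generator\<close>).

  The functor \<open>- \<bullet> C\<close> is the functor \<open>C \<bullet> -\<close> of the category with the reversed tensor product, which is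
  semiunital semimonoidal with \<open>\<rho>\<close> and \<open>\<wp>\<close> in the place of \<open>\<omega>\<close> and \<open>\<l>\<close>. The comonads obtained there
  are relative to \<open>- \<bullet> \<I>\<close>; composing the counits with \<open>\<wp> : - \<bullet> \<I> \<rightarrow> \<I> \<bullet> -\<close> makes them relative to \<open>\<I> \<bullet> -\<close>.
\<close>

section \<open>Arrows, isomorphisms and natural transformations\<close>

context category
begin

lemma cmp_ar [simp]:
  assumes "f \<in> ar V" "g \<in> ar V" "tgt V f = src V g"
  shows "g \<cdot> f \<in> ar V" "src V (g \<cdot> f) = src V f" "tgt V (g \<cdot> f) = tgt V g"
  using cmp_hom[of f "src V f" "src V g" g "tgt V g"] assms by (auto simp: hom_def)

lemma idt_ar [simp]:
  assumes "X \<in> ob V"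
  shows "idt V X \<in> ar V" "src V (idt V X) = X" "tgt V (idt V X) = X"
  using idt_hom[OF assms] by (auto simp: hom_def)

lemma ob_ends [simp]: "f \<in> ar V \<Longrightarrow> src V f \<in> ob V" "f \<in> ar V \<Longrightarrow> tgt V f \<in> ob V"
  by (auto intro: src_ob tgt_ob)

lemma idt_neutral [simp]:
  "f \<in> ar V \<Longrightarrow> tgt V f = X \<Longrightarrow> idt V X \<cdot> f = f"
  "f \<in> ar V \<Longrightarrow> src V f = X \<Longrightarrow> f \<cdot> idt V X = f"
  by (auto intro!: cmp_idt_left cmp_idt_right simp: hom_def)

lemma cmp_assoc_ar:
  "f \<in> ar V \<Longrightarrow> g \<in> ar V \<Longrightarrow> h \<in> ar V \<Longrightarrow> tgt V f = src V g \<Longrightarrow> tgt V g = src V h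
    \<Longrightarrow> (h \<cdot> g) \<cdot> f = h \<cdot> (g \<cdot> f)"
  by (rule cmp_assoc[of f "src V f" "src V g" g "src V h" h "tgt V h"]) (auto simp: hom_def)

lemma inverse_arrows_unique:
  assumes "inverse_arrows V f g" "inverse_arrows V f h"
  shows "g = h"
proof -
  have "g \<cdot> (f \<cdot> h) = g" "(g \<cdot> f) \<cdot> h = h"
    using assms by (simp_all add: inverse_arrows_def hom_def)
  moreover have "(g \<cdot> f) \<cdot> h = g \<cdot> (f \<cdot> h)"
    using assms by (intro cmp_assoc_ar) (auto simp: inverse_arrows_def hom_def)
  ultimately show ?thesis by simp
qed

lemma inv_ar_eq: "inverse_arrows V f g \<Longrightarrow> inv_ar V f = g"
  unfolding inv_ar_def by (blast intro: inverse_arrows_unique)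

lemma inv_ar_inverse:
  assumes "is_iso V f"
  shows "inverse_arrows V f (inv_ar V f)"
proof -
  obtain g where "inverse_arrows V f g"
    using assms by (auto simp: is_iso_def)
  then show ?thesis by (simp add: inv_ar_eq)
qed

lemma inv_ar [simp]:
  assumes "is_iso V f"
  shows "f \<in> ar V" "inv_ar V f \<in> ar V" "src V (inv_ar V f) = tgt V f" "tgt V (inv_ar V f) = src V f"
    "inv_ar V f \<cdot> f = idt V (src V f)" "f \<cdot> inv_ar V f = idt V (tgt V f)"
  using inv_ar_inverse[OF assms] by (auto simp: inverse_arrows_def hom_def)

lemma inv_ar_cmp [simp]:
  assumes "is_iso V f"
  shows "g \<in> ar V \<Longrightarrow> tgt V g = src V f \<Longrightarrow> inv_ar V f \<cdot> (f \<cdot> g) = g"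
    "g \<in> ar V \<Longrightarrow> tgt V g = tgt V f \<Longrightarrow> f \<cdot> (inv_ar V f \<cdot> g) = g"
  using assms by (simp_all add: cmp_assoc_ar[symmetric])

lemma inverse_arrows_inv: "is_iso V f \<Longrightarrow> inverse_arrows V (inv_ar V f) f"
  by (simp add: inverse_arrows_def hom_def)

lemma is_iso_inv [simp]: "is_iso V f \<Longrightarrow> is_iso V (inv_ar V f)"
  unfolding is_iso_def[of V "inv_ar V f"] by (blast intro: inverse_arrows_inv)

lemma inv_ar_inv [simp]: "is_iso V f \<Longrightarrow> inv_ar V (inv_ar V f) = f"
  by (intro inv_ar_eq inverse_arrows_inv)

lemma inverse_arrows_cmp:
  assumes "is_iso V f" "is_iso V g" "tgt V f = src V g"
  shows "inverse_arrows V (g \<cdot> f) (inv_ar V f \<cdot> inv_ar V g)"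
  using assms by (simp add: inverse_arrows_def hom_def cmp_assoc_ar)

lemma is_iso_cmp: "is_iso V f \<Longrightarrow> is_iso V g \<Longrightarrow> tgt V f = src V g \<Longrightarrow> is_iso V (g \<cdot> f)"
  unfolding is_iso_def[of V "g \<cdot> f"] by (blast intro: inverse_arrows_cmp)

lemma inv_ar_of_cmp:
  "is_iso V f \<Longrightarrow> is_iso V g \<Longrightarrow> tgt V f = src V g \<Longrightarrow> inv_ar V (g \<cdot> f) = inv_ar V f \<cdot> inv_ar V g"
  by (intro inv_ar_eq inverse_arrows_cmp)

lemma iso_cancel_left:
  assumes "is_iso V f" "f \<cdot> g = f \<cdot> h" "g \<in> ar V" "h \<in> ar V" "tgt V g = src V f" "tgt V h = src V f"
  shows "g = h"
proof -
  have "g = inv_ar V f \<cdot> (f \<cdot> g)" using assms(1,3,5) by simp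
  also have "\<dots> = h" unfolding assms(2) using assms(1,4,6) by simp
  finally show ?thesis .
qed

lemma iso_cancel_left_iff:
  assumes "is_iso V f" "g \<in> ar V" "h \<in> ar V" "tgt V g = src V f" "tgt V h = src V f"
  shows "f \<cdot> g = f \<cdot> h \<longleftrightarrow> g = h"
  using iso_cancel_left[OF assms(1) _ assms(2-)] by blast

lemma iso_cancel_right:
  assumes "is_iso V f" "g \<cdot> f = h \<cdot> f" "g \<in> ar V" "h \<in> ar V" "src V g = tgt V f" "src V h = tgt V f"
  shows "g = h"
proof -
  have "g = (g \<cdot> f) \<cdot> inv_ar V f" using assms(1,3,5) by (simp add: cmp_assoc_ar)
  also have "\<dots> = h" unfolding assms(2) using assms(1,4,6) by (simp add: cmp_assoc_ar)
  finally show ?thesis .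
qed

end

lemma nat_transD:
  assumes "nat_trans A B F G \<tau>"
  shows "X \<in> ob A \<Longrightarrow> \<tau> X \<in> hom B (fo F X) (fo G X)"
    "f \<in> hom A X Y \<Longrightarrow> \<tau> Y \<cdot>\<^bsub>B\<^esub> fa F f = fa G f \<cdot>\<^bsub>B\<^esub> \<tau> X"
  using assms by (auto simp: nat_trans_def hom_def)

lemma is_functorD:
  assumes "is_functor A B F"
  shows "X \<in> ob A \<Longrightarrow> fo F X \<in> ob B"
    "f \<in> hom A X Y \<Longrightarrow> fa F f \<in> hom B (fo F X) (fo F Y)"
    "X \<in> ob A \<Longrightarrow> fa F (idt A X) = idt B (fo F X)"
    "f \<in> hom A X Y \<Longrightarrow> g \<in> hom A Y Z \<Longrightarrow> fa F (g \<cdot>\<^bsub>A\<^esub> f) = fa F g \<cdot>\<^bsub>B\<^esub> fa F f"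
  using assms by (auto simp: is_functor_def hom_def)

lemma is_functor_comp:
  assumes "is_functor A B F" "is_functor B D G"
  shows "is_functor A D (comp_functor G F)"
  using assms by (auto simp: is_functor_def comp_functor_def hom_def)


section \<open>Regular generators and functors that preserve colimits\<close>

lemma colimit_arrow_unique:
  assumes "category J" "category V" "is_functor J V D" "is_colimit J V D X \<iota>"
    and h: "h \<in> hom V X Y" and k: "k \<in> hom V X Y"
    and eq: "\<And>j. j \<in> ob J \<Longrightarrow> h \<cdot>\<^bsub>V\<^esub> \<iota> j = k \<cdot>\<^bsub>V\<^esub> \<iota> j"
  shows "h = k"
proof -
  interpret J: category J by fact
  interpret category V by fact
  have cocone: "is_cocone J V D X \<iota>"
    using assms(4) by (simp add: is_colimit_def)
  have "is_cocone J V D Y (\<lambda>j. h \<cdot>\<^bsub>V\<^esub> \<iota> j)"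
    unfolding is_cocone_def
  proof (intro conjI ballI)
    show "Y \<in> ob V" using h tgt_ob by (auto simp: hom_def)
    show "h \<cdot>\<^bsub>V\<^esub> \<iota> j \<in> hom V (fo D j) Y" if "j \<in> ob J" for j
      using cocone h that by (auto simp: is_cocone_def intro: cmp_hom)
    fix u assume u: "u \<in> ar J"
    then have "fa D u \<in> hom V (fo D (src J u)) (fo D (tgt J u))"
      using assms(3) by (simp add: is_functor_def)
    then have "(h \<cdot>\<^bsub>V\<^esub> \<iota> (tgt J u)) \<cdot>\<^bsub>V\<^esub> fa D u = h \<cdot>\<^bsub>V\<^esub> (\<iota> (tgt J u) \<cdot>\<^bsub>V\<^esub> fa D u)"
      using cocone h u by (intro cmp_assoc) (auto simp: is_cocone_def)
    then show "(h \<cdot>\<^bsub>V\<^esub> \<iota> (tgt J u)) \<cdot>\<^bsub>V\<^esub> fa D u = h \<cdot>\<^bsub>V\<^esub> \<iota> (src J u)"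
      using cocone u by (simp add: is_cocone_def)
  qed
  then have "\<exists>!l. l \<in> hom V X Y \<and> (\<forall>j \<in> ob J. l \<cdot>\<^bsub>V\<^esub> \<iota> j = h \<cdot>\<^bsub>V\<^esub> \<iota> j)"
    using assms(4) by (simp add: is_colimit_def)
  then show ?thesis using h k eq by metis
qed

lemma category_discrete_cat: "category (discrete_cat S)"
  by unfold_locales (auto simp: discrete_cat_def hom_def)

text \<open>
  The injection \<open>\<phi>\<close> moves the index set into the type of the shapes over which preservation of
  colimits is stated.
\<close>

lemma coproduct_reindex:
  assumes "is_coproduct V S (\<lambda>_. G) X \<iota>" and inj: "inj_on \<phi> S"
  shows "is_coproduct V (\<phi> ` S) (\<lambda>_. G) X (\<lambda>t. \<iota> (inv_into S \<phi> t))"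
  unfolding is_coproduct_def is_colimit_def
proof (intro conjI allI impI)
  have cocone: "is_cocone (discrete_cat S) V \<lparr>fo = \<lambda>_. G, fa = \<lambda>_. idt V G\<rparr> X \<iota>"
    and univ: "\<And>Y \<kappa>. is_cocone (discrete_cat S) V \<lparr>fo = \<lambda>_. G, fa = \<lambda>_. idt V G\<rparr> Y \<kappa>
      \<Longrightarrow> \<exists>!h. h \<in> hom V X Y \<and> (\<forall>s \<in> S. h \<cdot>\<^bsub>V\<^esub> \<iota> s = \<kappa> s)"
    using assms(1) by (auto simp: is_coproduct_def is_colimit_def discrete_cat_def)
  show "is_cocone (discrete_cat (\<phi> ` S)) V \<lparr>fo = \<lambda>_. G, fa = \<lambda>_. idt V G\<rparr> X
      (\<lambda>t. \<iota> (inv_into S \<phi> t))"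
    using cocone inj by (auto simp: is_cocone_def discrete_cat_def)
  fix Y \<kappa>
  assume "is_cocone (discrete_cat (\<phi> ` S)) V \<lparr>fo = \<lambda>_. G, fa = \<lambda>_. idt V G\<rparr> Y \<kappa>"
  then have "is_cocone (discrete_cat S) V \<lparr>fo = \<lambda>_. G, fa = \<lambda>_. idt V G\<rparr> Y (\<lambda>s. \<kappa> (\<phi> s))"
    by (auto simp: is_cocone_def discrete_cat_def)
  from univ[OF this]
  show "\<exists>!h. h \<in> hom V X Y \<and>
      (\<forall>t \<in> ob (discrete_cat (\<phi> ` S)). h \<cdot>\<^bsub>V\<^esub> \<iota> (inv_into S \<phi> t) = \<kappa> t)"
    using inj by (simp add: discrete_cat_def)
qed

text \<open>
  The shape \<open>a \<rightrightarrows> b\<close> with arrows \<open>u, v\<close>; identity arrows are named by their objects, which makes a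
  set of four elements sufficient.
\<close>

definition parallel_cat :: "'j \<Rightarrow> 'j \<Rightarrow> 'j \<Rightarrow> 'j \<Rightarrow> ('j, 'j) cat" where
  "parallel_cat a b u v =
     \<lparr>ob = {a, b}, ar = {a, b, u, v}, src = (\<lambda>x. if x = b then b else a),
      tgt = (\<lambda>x. if x = a then a else b), idt = (\<lambda>x. x),
      cmp = (\<lambda>y x. if y = a \<or> y = b then x else y)\<rparr>"

lemma category_parallel_cat: "distinct [a, b, u, v] \<Longrightarrow> category (parallel_cat a b u v)"
  by unfold_locales (auto simp: parallel_cat_def hom_def split: if_splits)

lemma coequalizer_colimit:
  fixes a b u v :: 'j
  assumes "category V" "is_coequalizer V p q e" and dist: "distinct [a, b, u, v]"
  defines "D \<equiv> \<lparr>fo = (\<lambda>j. if j = a then src V p else tgt V p),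
    fa = (\<lambda>j. if j = a then idt V (src V p) else if j = b then idt V (tgt V p)
      else if j = u then p else q)\<rparr>"
  shows "is_functor (parallel_cat a b u v) V D"
    and "is_colimit (parallel_cat a b u v) V D (tgt V e) (\<lambda>j. if j = a then e \<cdot>\<^bsub>V\<^esub> p else e)"
proof -
  interpret category V by fact
  obtain A B Q where pqe: "p \<in> hom V A B" "q \<in> hom V A B" "e \<in> hom V B Q"
      "e \<cdot>\<^bsub>V\<^esub> p = e \<cdot>\<^bsub>V\<^esub> q"
    and univ: "\<And>Y h. h \<in> hom V B Y \<Longrightarrow> h \<cdot>\<^bsub>V\<^esub> p = h \<cdot>\<^bsub>V\<^esub> q \<Longrightarrow>
      \<exists>!k. k \<in> hom V Q Y \<and> k \<cdot>\<^bsub>V\<^esub> e = h"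
    using assms(2) unfolding is_coequalizer_def by blast
  have ends: "p \<in> ar V" "src V p = A" "tgt V p = B" "q \<in> ar V" "src V q = A" "tgt V q = B"
      "e \<in> ar V" "src V e = B" "tgt V e = Q" "A \<in> ob V" "B \<in> ob V" "Q \<in> ob V"
    using pqe src_ob tgt_ob by (auto simp: hom_def)
  show "is_functor (parallel_cat a b u v) V D"
    using ends dist by (auto simp: is_functor_def parallel_cat_def D_def hom_def split: if_splits)
  show "is_colimit (parallel_cat a b u v) V D (tgt V e) (\<lambda>j. if j = a then e \<cdot>\<^bsub>V\<^esub> p else e)"
    unfolding is_colimit_def
  proof (intro conjI allI impI)
    show "is_cocone (parallel_cat a b u v) V D (tgt V e) (\<lambda>j. if j = a then e \<cdot>\<^bsub>V\<^esub> p else e)"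
      using ends dist pqe by (auto simp: is_cocone_def parallel_cat_def D_def hom_def)
    fix Y \<kappa>
    assume "is_cocone (parallel_cat a b u v) V D Y \<kappa>"
    then have \<kappa>: "\<kappa> a = \<kappa> b \<cdot>\<^bsub>V\<^esub> p" "\<kappa> a = \<kappa> b \<cdot>\<^bsub>V\<^esub> q" "\<kappa> b \<in> hom V B Y"
      using ends dist by (auto simp: is_cocone_def parallel_cat_def D_def)
    have legs: "(k \<in> hom V Q Y \<and> k \<cdot>\<^bsub>V\<^esub> e = \<kappa> b) \<longleftrightarrow>
        (k \<in> hom V (tgt V e) Y \<and>
         (\<forall>j \<in> ob (parallel_cat a b u v). k \<cdot>\<^bsub>V\<^esub> (if j = a then e \<cdot>\<^bsub>V\<^esub> p else e) = \<kappa> j))" for k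
    proof -
      have "k \<cdot>\<^bsub>V\<^esub> (e \<cdot>\<^bsub>V\<^esub> p) = \<kappa> a" if "k \<in> hom V Q Y" "k \<cdot>\<^bsub>V\<^esub> e = \<kappa> b"
        unfolding \<kappa>(1) that(2)[symmetric] using ends that(1)
        by (intro cmp_assoc_ar[symmetric]) (auto simp: hom_def)
      moreover have "ob (parallel_cat a b u v) = {a, b}"
        by (simp add: parallel_cat_def)
      moreover have "b \<noteq> a" using dist by auto
      ultimately show ?thesis
        unfolding ends(9) by simp blast
    qed
    have "\<kappa> b \<cdot>\<^bsub>V\<^esub> p = \<kappa> b \<cdot>\<^bsub>V\<^esub> q"
      using \<kappa>(1,2) by (rule trans[OF sym])
    then show "\<exists>!k. k \<in> hom V (tgt V e) Y \<and>
        (\<forall>j \<in> ob (parallel_cat a b u v). k \<cdot>\<^bsub>V\<^esub> (if j = a then e \<cdot>\<^bsub>V\<^esub> p else e) = \<kappa> j)"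
      unfolding legs[symmetric] by (rule univ[OF \<kappa>(3)])
  qed
qed

text \<open>
  The image of \<open>e\<close> under \<open>F\<close> is a leg of a colimit cocone whose other leg factors through it, so it is
  epic.
\<close>

lemma preserves_colimits_regular_epi:
  assumes "infinite (UNIV :: 'u set)" "category V" "category W" "is_functor V W F"
    and "preserves_colimits TYPE('u) V W F" "regular_epi V e"
    and h: "h \<in> hom W (fo F (tgt V e)) Y" and k: "k \<in> hom W (fo F (tgt V e)) Y"
    and eq: "h \<cdot>\<^bsub>W\<^esub> fa F e = k \<cdot>\<^bsub>W\<^esub> fa F e"
  shows "h = k"
proof -
  interpret V: category V by fact
  interpret W: category W by fact
  obtain p q where coeq: "is_coequalizer V p q e"
    using assms(6) by (auto simp: regular_epi_def)
  obtain g :: "nat \<Rightarrow> 'u" where g: "inj g"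
    using assms(1) infinite_countable_subset by blast
  define a b u v where "a = g 0" and "b = g 1" and "u = g 2" and "v = g 3"
  note abuv = a_def b_def u_def v_def
  have dist: "distinct [a, b, u, v]"
    using g by (auto simp: abuv inj_eq)
  define J where "J = parallel_cat a b u v"
  have J: "category J" unfolding J_def by (rule category_parallel_cat[OF dist])
  have "finite (ar J)" by (simp add: J_def parallel_cat_def)
  then have small: "small_category J"
    using J assms(1) by (simp add: small_category_def small_def finite_lesspoll_infinite)
  obtain D where D: "is_functor J V D"
      "is_colimit J V D (tgt V e) (\<lambda>j. if j = a then e \<cdot>\<^bsub>V\<^esub> p else e)"
    unfolding J_def using coequalizer_colimit[OF assms(2) coeq dist] by blast
  obtain A B where pe: "p \<in> hom V A B" "e \<in> hom V B (tgt V e)"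
    using coeq by (auto simp: is_coequalizer_def hom_def)
  have Fep: "fa F (e \<cdot>\<^bsub>V\<^esub> p) = fa F e \<cdot>\<^bsub>W\<^esub> fa F p"
    and Fp: "fa F p \<in> hom W (fo F A) (fo F B)"
    and Fe: "fa F e \<in> hom W (fo F B) (fo F (tgt V e))"
    using is_functorD[OF assms(4)] pe by blast+
  have "is_colimit J W (comp_functor F D) (fo F (tgt V e))
      (\<lambda>j. fa F (if j = a then e \<cdot>\<^bsub>V\<^esub> p else e))"
    using assms(5) small D by (auto simp: preserves_colimits_def)
  moreover have "h \<cdot>\<^bsub>W\<^esub> fa F (e \<cdot>\<^bsub>V\<^esub> p) = k \<cdot>\<^bsub>W\<^esub> fa F (e \<cdot>\<^bsub>V\<^esub> p)"
    unfolding Fep W.cmp_assoc[OF Fp Fe h, symmetric] W.cmp_assoc[OF Fp Fe k, symmetric] eq ..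
  ultimately show ?thesis
    using colimit_arrow_unique[OF J assms(3) is_functor_comp[OF D(1) assms(4)] _ h k] eq by auto
qed

text \<open>
  Write \<open>X\<close> as a regular quotient \<open>e\<close> of a coproduct of copies of \<open>G\<close>. A functor that preserves
  colimits keeps the coproduct injections jointly epic and keeps \<open>e\<close> epic, hence also the
  composites, which are the arrows \<open>G \<rightarrow> X\<close>, jointly epic.
\<close>

lemma regular_generator_jointly_epic:
  assumes "infinite (UNIV :: 'u set)" "category V" "category W" "is_functor V W F"
    and "locally_small TYPE('u) V" "preserves_colimits TYPE('u) V W F" "regular_generator V G"
    and X: "X \<in> ob V"
    and h: "h \<in> hom W (fo F X) Y" and k: "k \<in> hom W (fo F X) Y"
    and eq: "\<And>f. f \<in> hom V G X \<Longrightarrow> h \<cdot>\<^bsub>W\<^esub> fa F f = k \<cdot>\<^bsub>W\<^esub> fa F f"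
  shows "h = k"
proof -
  interpret V: category V by fact
  interpret W: category W by fact
  obtain S \<iota> e where cop: "is_coproduct V (hom V G X) (\<lambda>_. G) S \<iota>"
    and e: "e \<in> hom V S X" "\<And>f. f \<in> hom V G X \<Longrightarrow> e \<cdot>\<^bsub>V\<^esub> \<iota> f = f" "regular_epi V e"
    and G: "G \<in> ob V"
    using assms(7) X unfolding regular_generator_def by metis
  have \<iota>: "\<iota> f \<in> hom V G S" if "f \<in> hom V G X" for f
    using cop that by (auto simp: is_coproduct_def is_colimit_def is_cocone_def discrete_cat_def)
  have hom_small: "hom V G X \<prec> (UNIV :: 'u set)"
    using assms(5) G X by (simp add: locally_small_def small_def)
  then obtain \<phi> :: "_ \<Rightarrow> 'u" where \<phi>: "inj_on \<phi> (hom V G X)"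
    by (auto simp: lesspoll_def lepoll_def)
  define T where "T = \<phi> ` hom V G X"
  define \<psi> where "\<psi> = inv_into (hom V G X) \<phi>"
  define D where "D = \<lparr>fo = \<lambda>_::'u. G, fa = \<lambda>_::'u. idt V G\<rparr>"
  have \<psi>: "\<psi> t \<in> hom V G X" if "t \<in> T" for t
    using that by (auto simp: T_def \<psi>_def intro: inv_into_into)
  have "T \<prec> (UNIV :: 'u set)"
    unfolding T_def using \<phi> hom_small by (meson eq_lesspoll_trans inj_on_image_eqpoll_self)
  then have small: "small_category (discrete_cat T)"
    using category_discrete_cat[of T] by (simp add: small_category_def small_def discrete_cat_def)
  have D: "is_functor (discrete_cat T) V D"
    using G by (auto simp: is_functor_def discrete_cat_def D_def hom_def)
  have colim: "is_colimit (discrete_cat T) V D S (\<lambda>t. \<iota> (\<psi> t))"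
    using coproduct_reindex[OF cop \<phi>] by (simp add: is_coproduct_def T_def \<psi>_def D_def)
  have F_colim: "is_colimit (discrete_cat T) W (comp_functor F D) (fo F S) (\<lambda>t. fa F (\<iota> (\<psi> t)))"
    using assms(6) small D colim by (auto simp: preserves_colimits_def)
  have Fe: "fa F e \<in> hom W (fo F S) (fo F X)"
    using is_functorD(2)[OF assms(4) e(1)] .
  have leg: "(l \<cdot>\<^bsub>W\<^esub> fa F e) \<cdot>\<^bsub>W\<^esub> fa F (\<iota> f) = l \<cdot>\<^bsub>W\<^esub> fa F f"
    if "f \<in> hom V G X" "l \<in> hom W (fo F X) Y" for l f
  proof -
    have "(l \<cdot>\<^bsub>W\<^esub> fa F e) \<cdot>\<^bsub>W\<^esub> fa F (\<iota> f) = l \<cdot>\<^bsub>W\<^esub> (fa F e \<cdot>\<^bsub>W\<^esub> fa F (\<iota> f))"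
      using is_functorD(2)[OF assms(4) \<iota>[OF that(1)]] Fe that(2) by (rule W.cmp_assoc)
    also have "fa F e \<cdot>\<^bsub>W\<^esub> fa F (\<iota> f) = fa F f"
      using is_functorD(4)[OF assms(4) \<iota>[OF that(1)] e(1)] e(2)[OF that(1)] by simp
    finally show ?thesis .
  qed
  have "h \<cdot>\<^bsub>W\<^esub> fa F e = k \<cdot>\<^bsub>W\<^esub> fa F e"
  proof (rule colimit_arrow_unique[OF category_discrete_cat[of T] assms(3)
        is_functor_comp[OF D assms(4)] F_colim])
    show "h \<cdot>\<^bsub>W\<^esub> fa F e \<in> hom W (fo F S) Y" using Fe h by (rule W.cmp_hom)
    show "k \<cdot>\<^bsub>W\<^esub> fa F e \<in> hom W (fo F S) Y" using Fe k by (rule W.cmp_hom)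
    fix t assume "t \<in> ob (discrete_cat T)"
    then have "\<psi> t \<in> hom V G X" using \<psi> by (simp add: discrete_cat_def)
    then show "(h \<cdot>\<^bsub>W\<^esub> fa F e) \<cdot>\<^bsub>W\<^esub> fa F (\<iota> (\<psi> t)) = (k \<cdot>\<^bsub>W\<^esub> fa F e) \<cdot>\<^bsub>W\<^esub> fa F (\<iota> (\<psi> t))"
      using leg h k eq by simp
  qed
  moreover have "tgt V e = X" using e(1) by (simp add: hom_def)
  ultimately show ?thesis
    using preserves_colimits_regular_epi[OF assms(1-4,6) e(3)] h k by simp
qed

lemma nat_trans_eq_if_eq_at_generator:
  assumes "infinite (UNIV :: 'u set)" "category V" "category W" "is_functor V W F"
    and "locally_small TYPE('u) V" "preserves_colimits TYPE('u) V W F" "regular_generator V G"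
    and \<sigma>: "nat_trans V W F H \<sigma>" and \<tau>: "nat_trans V W F H \<tau>" and eq: "\<sigma> G = \<tau> G"
    and X: "X \<in> ob V"
  shows "\<sigma> X = \<tau> X"
proof (rule regular_generator_jointly_epic[OF assms(1-7) X])
  show "\<sigma> X \<in> hom W (fo F X) (fo H X)" "\<tau> X \<in> hom W (fo F X) (fo H X)"
    using nat_transD(1)[OF \<sigma> X] nat_transD(1)[OF \<tau> X] .
  show "\<sigma> X \<cdot>\<^bsub>W\<^esub> fa F f = \<tau> X \<cdot>\<^bsub>W\<^esub> fa F f" if "f \<in> hom V G X" for f
    using nat_transD(2)[OF \<sigma> that] nat_transD(2)[OF \<tau> that] eq by simp
qed


section \<open>Semiunital semimonoidal categories\<close>

context semimonoidal
begin

lemma tensor_ar [simp]: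
  assumes "f \<in> ar V" "g \<in> ar V"
  shows "f \<otimes> g \<in> ar V" "src V (f \<otimes> g) = src V f \<bullet> src V g" "tgt V (f \<otimes> g) = tgt V f \<bullet> tgt V g"
  using tensor_hom[of f "src V f" "tgt V f" g "src V g" "tgt V g"] assms by (auto simp: hom_def)

lemma assoc_ar [simp]:
  assumes "X \<in> ob V" "Y \<in> ob V" "Z \<in> ob V"
  shows "\<gamma> X Y Z \<in> ar V" "src V (\<gamma> X Y Z) = (X \<bullet> Y) \<bullet> Z" "tgt V (\<gamma> X Y Z) = X \<bullet> (Y \<bullet> Z)"
  using assoc_hom[OF assms] by (auto simp: hom_def)

declare tensor_ob [simp] assoc_iso [simp] tensor_idt [simp]

lemma interchange:
  "f \<in> ar V \<Longrightarrow> f' \<in> ar V \<Longrightarrow> g \<in> ar V \<Longrightarrow> g' \<in> ar V \<Longrightarrow> tgt V f = src V f' \<Longrightarrow> tgt V g = src V g'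
    \<Longrightarrow> (f' \<otimes> g') \<cdot> (f \<otimes> g) = (f' \<cdot> f) \<otimes> (g' \<cdot> g)"
  by (rule tensor_cmp[symmetric, of _ "src V f" "src V f'" _ "tgt V f'" _ "src V g" "src V g'" _
        "tgt V g'"]) (auto simp: hom_def)

lemma assoc_nat_ar:
  "f \<in> ar V \<Longrightarrow> g \<in> ar V \<Longrightarrow> h \<in> ar V \<Longrightarrow> X = tgt V f \<Longrightarrow> Y = tgt V g \<Longrightarrow> Z = tgt V h \<Longrightarrow>
    \<gamma> X Y Z \<cdot> ((f \<otimes> g) \<otimes> h) = (f \<otimes> (g \<otimes> h)) \<cdot> \<gamma> (src V f) (src V g) (src V h)"
  using assoc_nat[of f "src V f" X g "src V g" Y h "src V h" Z] by (auto simp: hom_def)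

lemma inverse_arrows_tensor:
  "is_iso V f \<Longrightarrow> is_iso V g \<Longrightarrow> inverse_arrows V (f \<otimes> g) (inv_ar V f \<otimes> inv_ar V g)"
  by (simp add: inverse_arrows_def hom_def interchange)

lemma is_iso_tensor [simp]: "is_iso V f \<Longrightarrow> is_iso V g \<Longrightarrow> is_iso V (f \<otimes> g)"
  unfolding is_iso_def[of V "f \<otimes> g"] by (blast intro: inverse_arrows_tensor)

lemma inv_ar_tensor: "is_iso V f \<Longrightarrow> is_iso V g \<Longrightarrow> inv_ar V (f \<otimes> g) = inv_ar V f \<otimes> inv_ar V g"
  by (intro inv_ar_eq inverse_arrows_tensor)

lemma inverse_arrows_idt: "X \<in> ob V \<Longrightarrow> inverse_arrows V (idt V X) (idt V X)"
  by (simp add: inverse_arrows_def hom_def)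

lemma is_iso_idt [simp]: "X \<in> ob V \<Longrightarrow> is_iso V (idt V X)"
  unfolding is_iso_def by (blast intro: inverse_arrows_idt)

lemma inv_ar_idt [simp]: "X \<in> ob V \<Longrightarrow> inv_ar V (idt V X) = idt V X"
  by (intro inv_ar_eq inverse_arrows_idt)

lemma is_functor_tensor_left: "X \<in> ob V \<Longrightarrow> is_functor V V (tensor_left V X)"
  by (simp add: is_functor_def tensor_left_def hom_def interchange)

lemma is_functor_tensor_right: "X \<in> ob V \<Longrightarrow> is_functor V V (tensor_right V X)"
  by (simp add: is_functor_def tensor_right_def hom_def interchange)

end

text \<open>
  The right-handed counterpart \<open>X \<rightarrow> X \<bullet> \<I>\<close> of \<open>\<omega>\<close>, to which the second counit law of a
  semicomonoid refers.
\<close>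

definition rho :: "('o, 'a, 'm) semiunital_cat_scheme \<Rightarrow> 'o \<Rightarrow> 'a" ("\<rho>\<index>") where
  "rho V X = \<l>\<^bsub>V\<^esub> X \<cdot>\<^bsub>V\<^esub> \<omega>\<^bsub>V\<^esub> X"

context semiunital_semimonoidal
begin

declare semiunit_ob [simp] ell_iso [simp]

lemma omega_ar [simp]:
  "X \<in> ob V \<Longrightarrow> \<omega> X \<in> ar V" "X \<in> ob V \<Longrightarrow> src V (\<omega> X) = X" "X \<in> ob V \<Longrightarrow> tgt V (\<omega> X) = \<I> \<bullet> X"
  using nat_transD(1)[OF omega_nat] by (auto simp: hom_def id_functor_def tensor_left_def)

lemma omega_natural: "f \<in> ar V \<Longrightarrow> Y = tgt V f \<Longrightarrow> \<omega> Y \<cdot> f = (idt V \<I> \<otimes> f) \<cdot> \<omega> (src V f)"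
  using omega_nat by (auto simp: nat_trans_def id_functor_def tensor_left_def)

lemma ell_ar [simp]:
  "X \<in> ob V \<Longrightarrow> src V (\<l> X) = \<I> \<bullet> X" "X \<in> ob V \<Longrightarrow> tgt V (\<l> X) = X \<bullet> \<I>"
  using nat_transD(1)[OF ell_nat] by (auto simp: hom_def tensor_right_def tensor_left_def)

lemma ell_natural:
  "f \<in> ar V \<Longrightarrow> Y = tgt V f \<Longrightarrow> \<l> Y \<cdot> (idt V \<I> \<otimes> f) = (f \<otimes> idt V \<I>) \<cdot> \<l> (src V f)"
  using ell_nat by (auto simp: nat_trans_def tensor_right_def tensor_left_def)

lemma wp_natural:
  assumes f: "f \<in> ar V" and Y: "Y = tgt V f"
  shows "\<wp> Y \<cdot> (f \<otimes> idt V \<I>) = (idt V \<I> \<otimes> f) \<cdot> \<wp> (src V f)"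
proof (rule iso_cancel_left)
  show "is_iso V (\<l> Y)" using f Y by simp
  have "\<l> Y \<cdot> (\<wp> Y \<cdot> (f \<otimes> idt V \<I>)) = f \<otimes> idt V \<I>"
    using f Y by (simp add: wp_def)
  also have "\<dots> = ((f \<otimes> idt V \<I>) \<cdot> \<l> (src V f)) \<cdot> \<wp> (src V f)"
    using f Y by (simp add: wp_def cmp_assoc_ar)
  also have "\<dots> = (\<l> Y \<cdot> (idt V \<I> \<otimes> f)) \<cdot> \<wp> (src V f)"
    using ell_natural[OF f Y] by simp
  also have "\<dots> = \<l> Y \<cdot> ((idt V \<I> \<otimes> f) \<cdot> \<wp> (src V f))"
    using f Y by (simp add: wp_def cmp_assoc_ar)
  finally show "\<l> Y \<cdot> (\<wp> Y \<cdot> (f \<otimes> idt V \<I>)) = \<l> Y \<cdot> ((idt V \<I> \<otimes> f) \<cdot> \<wp> (src V f))" .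
qed (use f Y in \<open>simp_all add: wp_def\<close>)

lemma rho_ar [simp]:
  "X \<in> ob V \<Longrightarrow> \<rho> X \<in> ar V" "X \<in> ob V \<Longrightarrow> src V (\<rho> X) = X" "X \<in> ob V \<Longrightarrow> tgt V (\<rho> X) = X \<bullet> \<I>"
  by (simp_all add: rho_def)

lemma rho_natural:
  assumes "f \<in> ar V" "Y = tgt V f"
  shows "\<rho> Y \<cdot> f = (f \<otimes> idt V \<I>) \<cdot> \<rho> (src V f)"
proof -
  have "\<rho> Y \<cdot> f = \<l> Y \<cdot> ((idt V \<I> \<otimes> f) \<cdot> \<omega> (src V f))"
    using assms by (simp add: rho_def cmp_assoc_ar omega_natural)
  also have "\<dots> = (\<l> Y \<cdot> (idt V \<I> \<otimes> f)) \<cdot> \<omega> (src V f)"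
    using assms by (simp add: cmp_assoc_ar)
  also have "\<dots> = (f \<otimes> idt V \<I>) \<cdot> \<rho> (src V f)"
    unfolding ell_natural[OF assms] using assms by (simp add: rho_def cmp_assoc_ar)
  finally show ?thesis .
qed

text \<open>
  Express \<open>\<omega> (X \<bullet> Y)\<close> through \<open>X \<bullet> \<omega> Y\<close>. The law for \<open>\<l> (X \<bullet> Y)\<close> then produces a factor \<open>\<l> X \<bullet> Y\<close> next to
  \<open>\<wp> X \<bullet> Y\<close>, and the two cancel.
\<close>

lemma rho_tensor:
  assumes X: "X \<in> ob V" and Y: "Y \<in> ob V"
  shows "\<gamma> X Y \<I> \<cdot> \<rho> (X \<bullet> Y) = idt V X \<otimes> \<rho> Y"
proof -
  define w where "w = inv_ar V (\<gamma> X \<I> Y) \<cdot> (idt V X \<otimes> \<omega> Y)"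
  have w: "w \<in> ar V" "src V w = X \<bullet> Y" "tgt V w = (X \<bullet> \<I>) \<bullet> Y" "\<gamma> X \<I> Y \<cdot> w = idt V X \<otimes> \<omega> Y"
    using X Y by (simp_all add: w_def)
  have inverse: "(\<l> X \<otimes> idt V Y) \<cdot> ((\<wp> X \<otimes> idt V Y) \<cdot> w) = w"
  proof -
    have "(\<l> X \<otimes> idt V Y) \<cdot> ((\<wp> X \<otimes> idt V Y) \<cdot> w) = ((\<l> X \<otimes> idt V Y) \<cdot> (\<wp> X \<otimes> idt V Y)) \<cdot> w"
      using X Y w by (intro cmp_assoc_ar[symmetric]) (simp_all add: wp_def)
    also have "\<dots> = w"
      using X Y w by (simp add: interchange wp_def)
    finally show ?thesis .
  qed
  have "\<gamma> X Y \<I> \<cdot> \<rho> (X \<bullet> Y) = \<gamma> X Y \<I> \<cdot> (\<l> (X \<bullet> Y) \<cdot> (\<gamma> \<I> X Y \<cdot> ((\<wp> X \<otimes> idt V Y) \<cdot> w)))"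
    unfolding rho_def omega_tensor_right[OF X Y] w_def ..
  also have "\<dots> = (\<gamma> X Y \<I> \<cdot> \<l> (X \<bullet> Y) \<cdot> \<gamma> \<I> X Y) \<cdot> ((\<wp> X \<otimes> idt V Y) \<cdot> w)"
    using X Y w by (simp add: cmp_assoc_ar wp_def)
  also have "\<dots> = ((idt V X \<otimes> \<l> Y) \<cdot> \<gamma> X \<I> Y \<cdot> (\<l> X \<otimes> idt V Y)) \<cdot> ((\<wp> X \<otimes> idt V Y) \<cdot> w)"
    unfolding ell_tensor[OF X Y] ..
  also have "\<dots> = (idt V X \<otimes> \<l> Y) \<cdot> (\<gamma> X \<I> Y \<cdot> ((\<l> X \<otimes> idt V Y) \<cdot> ((\<wp> X \<otimes> idt V Y) \<cdot> w)))"
    using X Y w by (simp add: cmp_assoc_ar wp_def)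
  also have "\<dots> = idt V X \<otimes> \<rho> Y"
    unfolding inverse w using X Y by (simp add: interchange rho_def)
  finally show ?thesis .
qed

text \<open>
  The triangle identity of monoidal categories, with \<open>\<rho>\<close> and \<open>\<omega>\<close> in the place of the inverse
  unitors: composing either side with the isomorphism \<open>X \<bullet> \<l> Y\<close> gives \<open>\<gamma> X Y \<I> \<cdot> \<rho> (X \<bullet> Y)\<close>.
\<close>

lemma triangle:
  assumes X: "X \<in> ob V" and Y: "Y \<in> ob V"
  shows "\<gamma> X \<I> Y \<cdot> (\<rho> X \<otimes> idt V Y) = idt V X \<otimes> \<omega> Y"
proof (rule iso_cancel_left)
  show "is_iso V (idt V X \<otimes> \<l> Y)" using X Y by simp
  have "(idt V X \<otimes> \<l> Y) \<cdot> (\<gamma> X \<I> Y \<cdot> (\<rho> X \<otimes> idt V Y)) =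
      ((idt V X \<otimes> \<l> Y) \<cdot> \<gamma> X \<I> Y \<cdot> (\<l> X \<otimes> idt V Y)) \<cdot> (\<omega> X \<otimes> idt V Y)"
    using X Y by (simp add: cmp_assoc_ar interchange rho_def)
  also have "\<dots> = (\<gamma> X Y \<I> \<cdot> \<l> (X \<bullet> Y) \<cdot> \<gamma> \<I> X Y) \<cdot> (\<omega> X \<otimes> idt V Y)"
    unfolding ell_tensor[OF X Y] ..
  also have "\<dots> = \<gamma> X Y \<I> \<cdot> \<rho> (X \<bullet> Y)"
    unfolding rho_def omega_tensor_left[OF X Y] using X Y by (simp add: cmp_assoc_ar)
  also have "\<dots> = (idt V X \<otimes> \<l> Y) \<cdot> (idt V X \<otimes> \<omega> Y)"
    unfolding rho_tensor[OF X Y] using X Y by (simp add: rho_def interchange)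
  finally show "(idt V X \<otimes> \<l> Y) \<cdot> (\<gamma> X \<I> Y \<cdot> (\<rho> X \<otimes> idt V Y)) =
      (idt V X \<otimes> \<l> Y) \<cdot> (idt V X \<otimes> \<omega> Y)" .
qed (use X Y in simp_all)

lemma firmD: "firm V X \<Longrightarrow> X \<in> ob V" "firm V X \<Longrightarrow> is_iso V (\<omega> X)" "firm V X \<Longrightarrow> is_iso V (\<rho> X)"
  by (simp_all add: firm_def rho_def is_iso_cmp)

lemma is_iso_rho_tensor:
  assumes X: "X \<in> ob V" and Y: "firm V Y"
  shows "is_iso V (\<rho> (X \<bullet> Y))"
proof -
  have "\<rho> (X \<bullet> Y) = inv_ar V (\<gamma> X Y \<I>) \<cdot> (\<gamma> X Y \<I> \<cdot> \<rho> (X \<bullet> Y))"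
    using X firmD[OF Y] by simp
  also have "\<dots> = inv_ar V (\<gamma> X Y \<I>) \<cdot> (idt V X \<otimes> \<rho> Y)"
    using X firmD[OF Y] by (simp add: rho_tensor)
  finally show ?thesis
    using X firmD[OF Y] by (simp add: is_iso_cmp)
qed

text \<open>Naturality of \<open>\<rho>\<close> expresses \<open>\<rho> Y \<cdot> f\<close> through \<open>f \<bullet> \<I>\<close>.\<close>

lemma tensor_semiunit_cancel:
  assumes "is_iso V (\<rho> Y)" "f \<in> hom V X Y" "g \<in> hom V X Y" and eq: "f \<otimes> idt V \<I> = g \<otimes> idt V \<I>"
  shows "f = g"
proof (rule iso_cancel_left[OF assms(1)])
  have *: "f \<in> ar V" "src V f = X" "tgt V f = Y" "g \<in> ar V" "src V g = X" "tgt V g = Y"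
    using assms by (auto simp: hom_def)
  show "\<rho> Y \<cdot> f = \<rho> Y \<cdot> g"
    using * eq rho_natural[of f Y] rho_natural[of g Y] by simp
  have "Y \<in> ob V" using * ob_ends by blast
  then show "f \<in> ar V" "g \<in> ar V" "tgt V f = src V (\<rho> Y)" "tgt V g = src V (\<rho> Y)"
    using * by simp_all
qed

text \<open>
  Naturality of \<open>\<omega>\<close> at \<open>\<omega> \<I>\<close> gives \<open>\<omega> (\<I> \<bullet> \<I>) = \<I> \<bullet> \<omega> \<I>\<close>, because \<open>\<omega> \<I>\<close> can be cancelled. The
  left side is \<open>\<gamma> \<cdot> (\<omega> \<I> \<bullet> \<I>)\<close>, the right side is \<open>\<gamma> \<cdot> (\<rho> \<I> \<bullet> \<I>)\<close> by the triangle identity;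
  cancel \<open>\<gamma>\<close> and then the factor \<open>- \<bullet> \<I>\<close>.
\<close>

lemma rho_semiunit:
  assumes I: "firm V \<I>"
  shows "\<rho> \<I> = \<omega> \<I>"
proof (rule tensor_semiunit_cancel)
  note [simp] = firmD[OF I]
  show "is_iso V (\<rho> (\<I> \<bullet> \<I>))" using I by (simp add: is_iso_rho_tensor)
  show "\<rho> \<I> \<in> hom V \<I> (\<I> \<bullet> \<I>)" "\<omega> \<I> \<in> hom V \<I> (\<I> \<bullet> \<I>)" by (simp_all add: hom_def)
  have "\<omega> (\<I> \<bullet> \<I>) = idt V \<I> \<otimes> \<omega> \<I>"
    by (rule iso_cancel_right[of "\<omega> \<I>"]) (simp_all add: omega_natural)
  then have "\<gamma> \<I> \<I> \<I> \<cdot> (\<omega> \<I> \<otimes> idt V \<I>) = \<gamma> \<I> \<I> \<I> \<cdot> (\<rho> \<I> \<otimes> idt V \<I>)"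
    by (simp add: omega_tensor_left triangle)
  then show "\<rho> \<I> \<otimes> idt V \<I> = \<omega> \<I> \<otimes> idt V \<I>"
    by (simp add: iso_cancel_left_iff)
qed

end


section \<open>Comonads on the functor \<open>C \<bullet> -\<close>\<close>

context semiunital_semimonoidal
begin

text \<open>
  With the associativity isomorphisms written out, the comonad laws at \<open>X\<close> are the semicomonoid laws
  tensored with \<open>X\<close>: the following three lemmas compare the two sides of each law.
\<close>

context
  fixes C X \<Delta>
  assumes C: "C \<in> ob V" and X: "X \<in> ob V"
    and \<Delta>: "\<Delta> \<in> ar V" "src V \<Delta> = C" "tgt V \<Delta> = C \<bullet> C"
begin

lemma left_coassoc_iff:
  "(\<gamma> C C (C \<bullet> X) \<cdot> (\<Delta> \<otimes> idt V (C \<bullet> X))) \<cdot> (\<gamma> C C X \<cdot> (\<Delta> \<otimes> idt V X)) =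
     (idt V C \<otimes> (\<gamma> C C X \<cdot> (\<Delta> \<otimes> idt V X))) \<cdot> (\<gamma> C C X \<cdot> (\<Delta> \<otimes> idt V X)) \<longleftrightarrow>
   (\<gamma> C C C \<cdot> (\<Delta> \<otimes> idt V C) \<cdot> \<Delta>) \<otimes> idt V X = ((idt V C \<otimes> \<Delta>) \<cdot> \<Delta>) \<otimes> idt V X"
  (is "?L = ?R \<longleftrightarrow> ?l \<otimes> _ = ?r \<otimes> _")
proof -
  note [simp] = C X \<Delta>
  define K where "K = (idt V C \<otimes> \<gamma> C C X) \<cdot> \<gamma> C (C \<bullet> C) X"
  have K: "is_iso V K" "src V K = (C \<bullet> (C \<bullet> C)) \<bullet> X"
    by (simp_all add: K_def is_iso_cmp)
  have "?L = \<gamma> C C (C \<bullet> X) \<cdot> (((\<Delta> \<otimes> (idt V C \<otimes> idt V X)) \<cdot> \<gamma> C C X) \<cdot> (\<Delta> \<otimes> idt V X))"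
    by (simp add: cmp_assoc_ar)
  also have "(\<Delta> \<otimes> (idt V C \<otimes> idt V X)) \<cdot> \<gamma> C C X =
      \<gamma> (C \<bullet> C) C X \<cdot> ((\<Delta> \<otimes> idt V C) \<otimes> idt V X)"
    by (simp add: assoc_nat_ar)
  also have "\<gamma> C C (C \<bullet> X) \<cdot> ((\<gamma> (C \<bullet> C) C X \<cdot> ((\<Delta> \<otimes> idt V C) \<otimes> idt V X)) \<cdot> (\<Delta> \<otimes> idt V X)) =
      (\<gamma> C C (C \<bullet> X) \<cdot> \<gamma> (C \<bullet> C) C X) \<cdot> (((\<Delta> \<otimes> idt V C) \<cdot> \<Delta>) \<otimes> idt V X)"
    by (simp add: cmp_assoc_ar interchange)
  also have "\<dots> = K \<cdot> (?l \<otimes> idt V X)"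
    by (simp add: pentagon K_def cmp_assoc_ar interchange)
  finally have L: "?L = K \<cdot> (?l \<otimes> idt V X)" .
  have "?R = (idt V C \<otimes> \<gamma> C C X) \<cdot>
      (((idt V C \<otimes> (\<Delta> \<otimes> idt V X)) \<cdot> \<gamma> C C X) \<cdot> (\<Delta> \<otimes> idt V X))"
    by (simp add: cmp_assoc_ar[symmetric] interchange)
  also have "(idt V C \<otimes> (\<Delta> \<otimes> idt V X)) \<cdot> \<gamma> C C X =
      \<gamma> C (C \<bullet> C) X \<cdot> ((idt V C \<otimes> \<Delta>) \<otimes> idt V X)"
    by (simp add: assoc_nat_ar)
  also have "(idt V C \<otimes> \<gamma> C C X) \<cdot>
      ((\<gamma> C (C \<bullet> C) X \<cdot> ((idt V C \<otimes> \<Delta>) \<otimes> idt V X)) \<cdot> (\<Delta> \<otimes> idt V X)) = K \<cdot> (?r \<otimes> idt V X)"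
    by (simp add: K_def cmp_assoc_ar interchange)
  finally have R: "?R = K \<cdot> (?r \<otimes> idt V X)" .
  show ?thesis
    unfolding L R by (rule iso_cancel_left_iff) (simp_all add: K)
qed

lemma left_counit_omega_iff:
  assumes \<epsilon>: "\<epsilon> \<in> ar V" "src V \<epsilon> = C" "tgt V \<epsilon> = \<I>"
  shows "(\<epsilon> \<otimes> idt V (C \<bullet> X)) \<cdot> (\<gamma> C C X \<cdot> (\<Delta> \<otimes> idt V X)) = \<omega> (C \<bullet> X) \<longleftrightarrow>
   ((\<epsilon> \<otimes> idt V C) \<cdot> \<Delta>) \<otimes> idt V X = \<omega> C \<otimes> idt V X"
proof -
  note [simp] = C X \<Delta> \<epsilon>
  have "(\<epsilon> \<otimes> idt V (C \<bullet> X)) \<cdot> (\<gamma> C C X \<cdot> (\<Delta> \<otimes> idt V X)) =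
      ((\<epsilon> \<otimes> (idt V C \<otimes> idt V X)) \<cdot> \<gamma> C C X) \<cdot> (\<Delta> \<otimes> idt V X)"
    by (simp add: cmp_assoc_ar)
  also have "(\<epsilon> \<otimes> (idt V C \<otimes> idt V X)) \<cdot> \<gamma> C C X = \<gamma> \<I> C X \<cdot> ((\<epsilon> \<otimes> idt V C) \<otimes> idt V X)"
    by (simp add: assoc_nat_ar)
  also have "\<dots> \<cdot> (\<Delta> \<otimes> idt V X) = \<gamma> \<I> C X \<cdot> (((\<epsilon> \<otimes> idt V C) \<cdot> \<Delta>) \<otimes> idt V X)"
    by (simp add: cmp_assoc_ar interchange)
  finally show ?thesis
    by (simp add: omega_tensor_left iso_cancel_left_iff)
qed

lemma left_counit_rho_iff:
  assumes \<epsilon>: "\<epsilon> \<in> ar V" "src V \<epsilon> = C" "tgt V \<epsilon> = \<I>"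
  shows "(idt V C \<otimes> (\<epsilon> \<otimes> idt V X)) \<cdot> (\<gamma> C C X \<cdot> (\<Delta> \<otimes> idt V X)) = idt V C \<otimes> \<omega> X \<longleftrightarrow>
   ((idt V C \<otimes> \<epsilon>) \<cdot> \<Delta>) \<otimes> idt V X = \<rho> C \<otimes> idt V X"
proof -
  note [simp] = C X \<Delta> \<epsilon>
  have "(idt V C \<otimes> (\<epsilon> \<otimes> idt V X)) \<cdot> (\<gamma> C C X \<cdot> (\<Delta> \<otimes> idt V X)) =
      ((idt V C \<otimes> (\<epsilon> \<otimes> idt V X)) \<cdot> \<gamma> C C X) \<cdot> (\<Delta> \<otimes> idt V X)"
    by (simp add: cmp_assoc_ar)
  also have "(idt V C \<otimes> (\<epsilon> \<otimes> idt V X)) \<cdot> \<gamma> C C X = \<gamma> C \<I> X \<cdot> ((idt V C \<otimes> \<epsilon>) \<otimes> idt V X)"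
    by (simp add: assoc_nat_ar)
  also have "\<dots> \<cdot> (\<Delta> \<otimes> idt V X) = \<gamma> C \<I> X \<cdot> (((idt V C \<otimes> \<epsilon>) \<cdot> \<Delta>) \<otimes> idt V X)"
    by (simp add: cmp_assoc_ar interchange)
  finally show ?thesis
    by (simp add: triangle[symmetric] iso_cancel_left_iff)
qed

end

lemma semicomonoid_homs:
  assumes "(\<Delta>, \<epsilon>) \<in> semicomonoid_structures V C"
  shows "\<Delta> \<in> hom V C (C \<bullet> C)" "\<epsilon> \<in> hom V C \<I>"
  using assms by (simp_all only: semicomonoid_structures_def is_semicomonoid_def mem_Collect_eq
      prod.case)

lemma nat_trans_left_comultiplication:
  assumes "C \<in> ob V" "\<Delta> \<in> hom V C (C \<bullet> C)"
  shows "nat_trans V V (tensor_left V C) (comp_functor (tensor_left V C) (tensor_left V C))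
    (\<lambda>X \<in> ob V. \<gamma> C C X \<cdot> (\<Delta> \<otimes> idt V X))"
proof -
  have [simp]: "C \<in> ob V" "\<Delta> \<in> ar V" "src V \<Delta> = C" "tgt V \<Delta> = C \<bullet> C"
    using assms by (auto simp: hom_def)
  have "(\<gamma> C C (tgt V f) \<cdot> (\<Delta> \<otimes> idt V (tgt V f))) \<cdot> (idt V C \<otimes> f) =
      (idt V C \<otimes> (idt V C \<otimes> f)) \<cdot> (\<gamma> C C (src V f) \<cdot> (\<Delta> \<otimes> idt V (src V f)))" if [simp]: "f \<in> ar V" for f
  proof -
    have "(\<gamma> C C (tgt V f) \<cdot> (\<Delta> \<otimes> idt V (tgt V f))) \<cdot> (idt V C \<otimes> f) =
        \<gamma> C C (tgt V f) \<cdot> (((idt V C \<otimes> idt V C) \<otimes> f) \<cdot> (\<Delta> \<otimes> idt V (src V f)))"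
      by (simp add: cmp_assoc_ar interchange)
    also have "\<dots> = (\<gamma> C C (tgt V f) \<cdot> ((idt V C \<otimes> idt V C) \<otimes> f)) \<cdot> (\<Delta> \<otimes> idt V (src V f))"
      by (simp add: cmp_assoc_ar)
    also have "\<gamma> C C (tgt V f) \<cdot> ((idt V C \<otimes> idt V C) \<otimes> f) =
        (idt V C \<otimes> (idt V C \<otimes> f)) \<cdot> \<gamma> C C (src V f)"
      by (simp add: assoc_nat_ar del: tensor_idt)
    also have "\<dots> \<cdot> (\<Delta> \<otimes> idt V (src V f)) =
        (idt V C \<otimes> (idt V C \<otimes> f)) \<cdot> (\<gamma> C C (src V f) \<cdot> (\<Delta> \<otimes> idt V (src V f)))"
      by (simp add: cmp_assoc_ar)
    finally show ?thesis .
  qed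
  then show ?thesis
    by (simp add: nat_trans_def tensor_left_def comp_functor_def hom_def)
qed

lemma nat_trans_left_counit:
  assumes "C \<in> ob V" "\<epsilon> \<in> hom V C \<I>"
  shows "nat_trans V V (tensor_left V C) (tensor_left V \<I>) (\<lambda>X \<in> ob V. \<epsilon> \<otimes> idt V X)"
proof -
  have [simp]: "C \<in> ob V" "\<epsilon> \<in> ar V" "src V \<epsilon> = C" "tgt V \<epsilon> = \<I>"
    using assms by (auto simp: hom_def)
  show ?thesis
    by (simp add: nat_trans_def tensor_left_def hom_def interchange)
qed

text \<open>
  From right to left, a semicomonoid law may be tensored with every \<open>X\<close>. From left to right it is
  enough to look at \<open>X = \<I>\<close>: the targets \<open>C \<bullet> (C \<bullet> C)\<close>, \<open>\<I> \<bullet> C\<close> and \<open>C \<bullet> \<I>\<close> of the three laws end in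
  a firm object, so that the factor \<open>- \<bullet> \<I>\<close> can be cancelled.
\<close>

lemma left_comonad_of_iff:
  assumes I: "firm V \<I>" and C: "firm V C"
    and \<Delta>: "\<Delta> \<in> hom V C (C \<bullet> C)" and \<epsilon>: "\<epsilon> \<in> hom V C \<I>"
  shows "left_comonad_of V C (\<Delta>, \<epsilon>) \<in> J_comonad_structures V (tensor_left V \<I>) (tensor_left V C) \<omega>
    \<longleftrightarrow> (\<Delta>, \<epsilon>) \<in> semicomonoid_structures V C"
proof -
  note [simp] = firmD[OF I] firmD[OF C]
  have ends [simp]: "\<Delta> \<in> ar V" "src V \<Delta> = C" "tgt V \<Delta> = C \<bullet> C" "\<epsilon> \<in> ar V" "src V \<epsilon> = C" "tgt V \<epsilon> = \<I>"
    using \<Delta> \<epsilon> by (auto simp: hom_def)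
  define coassoc where "coassoc X \<longleftrightarrow>
    (\<gamma> C C C \<cdot> (\<Delta> \<otimes> idt V C) \<cdot> \<Delta>) \<otimes> idt V X = ((idt V C \<otimes> \<Delta>) \<cdot> \<Delta>) \<otimes> idt V X" for X
  define counit_omega where "counit_omega X \<longleftrightarrow>
    ((\<epsilon> \<otimes> idt V C) \<cdot> \<Delta>) \<otimes> idt V X = \<omega> C \<otimes> idt V X" for X
  define counit_rho where "counit_rho X \<longleftrightarrow>
    ((idt V C \<otimes> \<epsilon>) \<cdot> \<Delta>) \<otimes> idt V X = \<rho> C \<otimes> idt V X" for X
  have comonad: "left_comonad_of V C (\<Delta>, \<epsilon>)
      \<in> J_comonad_structures V (tensor_left V \<I>) (tensor_left V C) \<omega> \<longleftrightarrow>
      (\<forall>X \<in> ob V. coassoc X \<and> counit_omega X \<and> counit_rho X)"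
  proof -
    have "left_comonad_of V C (\<Delta>, \<epsilon>)
        \<in> J_comonad_structures V (tensor_left V \<I>) (tensor_left V C) \<omega> \<longleftrightarrow>
      (\<forall>X \<in> ob V.
        (\<gamma> C C (C \<bullet> X) \<cdot> (\<Delta> \<otimes> idt V (C \<bullet> X))) \<cdot> (\<gamma> C C X \<cdot> (\<Delta> \<otimes> idt V X)) =
          (idt V C \<otimes> (\<gamma> C C X \<cdot> (\<Delta> \<otimes> idt V X))) \<cdot> (\<gamma> C C X \<cdot> (\<Delta> \<otimes> idt V X)) \<and>
        (\<epsilon> \<otimes> idt V (C \<bullet> X)) \<cdot> (\<gamma> C C X \<cdot> (\<Delta> \<otimes> idt V X)) = \<omega> (C \<bullet> X) \<and>
        (idt V C \<otimes> (\<epsilon> \<otimes> idt V X)) \<cdot> (\<gamma> C C X \<cdot> (\<Delta> \<otimes> idt V X)) = idt V C \<otimes> \<omega> X)"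
      using is_functor_tensor_left[of C] is_functor_tensor_left[of \<I>] omega_nat
        nat_trans_left_comultiplication[OF _ \<Delta>] nat_trans_left_counit[OF _ \<epsilon>]
      by (simp add: J_comonad_structures_def left_comonad_of_def is_J_comonad_def)
        (simp add: tensor_left_def)
    then show ?thesis
      by (simp add: coassoc_def counit_omega_def counit_rho_def left_coassoc_iff
          left_counit_omega_iff left_counit_rho_iff)
  qed
  have semicomonoid: "(\<Delta>, \<epsilon>) \<in> semicomonoid_structures V C \<longleftrightarrow>
      \<gamma> C C C \<cdot> (\<Delta> \<otimes> idt V C) \<cdot> \<Delta> = (idt V C \<otimes> \<Delta>) \<cdot> \<Delta> \<and>
      (\<epsilon> \<otimes> idt V C) \<cdot> \<Delta> = \<omega> C \<and> (idt V C \<otimes> \<epsilon>) \<cdot> \<Delta> = \<rho> C"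
    using \<Delta> \<epsilon> by (simp add: semicomonoid_structures_def is_semicomonoid_def rho_def)
  show ?thesis
  proof
    assume "(\<Delta>, \<epsilon>) \<in> semicomonoid_structures V C"
    then show "left_comonad_of V C (\<Delta>, \<epsilon>)
        \<in> J_comonad_structures V (tensor_left V \<I>) (tensor_left V C) \<omega>"
      unfolding comonad semicomonoid
      by (simp add: coassoc_def counit_omega_def counit_rho_def)
  next
    assume "left_comonad_of V C (\<Delta>, \<epsilon>)
        \<in> J_comonad_structures V (tensor_left V \<I>) (tensor_left V C) \<omega>"
    then have at: "coassoc \<I>" "counit_omega \<I>" "counit_rho \<I>"
      unfolding comonad by simp_all
    have iso: "is_iso V (\<rho> (C \<bullet> (C \<bullet> C)))"
    proof -
      have "\<rho> (C \<bullet> (C \<bullet> C)) = inv_ar V (\<gamma> C (C \<bullet> C) \<I>) \<cdot> (\<gamma> C (C \<bullet> C) \<I> \<cdot> \<rho> (C \<bullet> (C \<bullet> C)))"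
        by simp
      also have "\<dots> = inv_ar V (\<gamma> C (C \<bullet> C) \<I>) \<cdot> (idt V C \<otimes> \<rho> (C \<bullet> C))"
        by (simp add: rho_tensor)
      finally show ?thesis
        using is_iso_rho_tensor[OF _ C, of C] by (simp add: is_iso_cmp)
    qed
    have "\<gamma> C C C \<cdot> (\<Delta> \<otimes> idt V C) \<cdot> \<Delta> = (idt V C \<otimes> \<Delta>) \<cdot> \<Delta>"
      using iso _ _ at(1)[unfolded coassoc_def]
      by (rule tensor_semiunit_cancel[where X = C]) (simp_all add: hom_def)
    moreover have "(\<epsilon> \<otimes> idt V C) \<cdot> \<Delta> = \<omega> C"
      using is_iso_rho_tensor[OF semiunit_ob C] _ _ at(2)[unfolded counit_omega_def]
      by (rule tensor_semiunit_cancel[where X = C]) (simp_all add: hom_def)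
    moreover have "(idt V C \<otimes> \<epsilon>) \<cdot> \<Delta> = \<rho> C"
      using is_iso_rho_tensor[OF firmD(1)[OF C] I] _ _ at(3)[unfolded counit_rho_def]
      by (rule tensor_semiunit_cancel[where X = C]) (simp_all add: hom_def)
    ultimately show "(\<Delta>, \<epsilon>) \<in> semicomonoid_structures V C"
      unfolding semicomonoid by blast
  qed
qed

text \<open>
  Conjugating the components at \<open>\<I>\<close> of a comonad structure by the isomorphisms \<open>\<rho>\<close> gives a
  candidate \<open>(\<Delta>, \<epsilon>)\<close>. Naturality of \<open>\<rho>\<close> shows that the induced families agree with the given ones at
  \<open>\<I>\<close>; agreement at all other objects is the generator argument.
\<close>

lemma left_families_from_semiunit:
  assumes I: "firm V \<I>" and C: "firm V C"
    and D: "D \<in> hom V (C \<bullet> \<I>) (C \<bullet> (C \<bullet> \<I>))" and T: "T \<in> hom V (C \<bullet> \<I>) (\<I> \<bullet> \<I>)"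
  obtains \<Delta> \<epsilon> where "\<Delta> \<in> hom V C (C \<bullet> C)" "\<epsilon> \<in> hom V C \<I>"
    "\<gamma> C C \<I> \<cdot> (\<Delta> \<otimes> idt V \<I>) = D" "\<epsilon> \<otimes> idt V \<I> = T"
proof
  note [simp] = firmD[OF I] firmD[OF C]
  have [simp]: "D \<in> ar V" "src V D = C \<bullet> \<I>" "tgt V D = C \<bullet> (C \<bullet> \<I>)"
      "T \<in> ar V" "src V T = C \<bullet> \<I>" "tgt V T = \<I> \<bullet> \<I>"
    using D T by (auto simp: hom_def)
  define \<Delta> where "\<Delta> = inv_ar V (idt V C \<otimes> \<rho> C) \<cdot> (D \<cdot> \<rho> C)"
  \<comment> \<open>The factor \<open>\<omega> \<I>\<close> is \<open>\<rho> \<I>\<close>, by \<open>rho_semiunit\<close>.\<close>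
  define \<epsilon> where "\<epsilon> = inv_ar V (\<omega> \<I>) \<cdot> (T \<cdot> \<rho> C)"
  have \<Delta> [simp]: "\<Delta> \<in> ar V" "src V \<Delta> = C" "tgt V \<Delta> = C \<bullet> C"
    by (simp_all add: \<Delta>_def)
  have \<epsilon> [simp]: "\<epsilon> \<in> ar V" "src V \<epsilon> = C" "tgt V \<epsilon> = \<I>"
    by (simp_all add: \<epsilon>_def)
  show "\<Delta> \<in> hom V C (C \<bullet> C)" "\<epsilon> \<in> hom V C \<I>" by (simp_all add: hom_def)
  show "\<gamma> C C \<I> \<cdot> (\<Delta> \<otimes> idt V \<I>) = D"
  proof (rule iso_cancel_right[of "\<rho> C"])
    have "(\<gamma> C C \<I> \<cdot> (\<Delta> \<otimes> idt V \<I>)) \<cdot> \<rho> C = \<gamma> C C \<I> \<cdot> (\<rho> (C \<bullet> C) \<cdot> \<Delta>)"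
      by (simp add: cmp_assoc_ar rho_natural)
    also have "\<dots> = (\<gamma> C C \<I> \<cdot> \<rho> (C \<bullet> C)) \<cdot> \<Delta>"
      by (simp add: cmp_assoc_ar)
    also have "\<dots> = (idt V C \<otimes> \<rho> C) \<cdot> \<Delta>"
      by (simp add: rho_tensor)
    also have "\<dots> = D \<cdot> \<rho> C"
      by (simp add: \<Delta>_def)
    finally show "(\<gamma> C C \<I> \<cdot> (\<Delta> \<otimes> idt V \<I>)) \<cdot> \<rho> C = D \<cdot> \<rho> C" .
  qed simp_all
  show "\<epsilon> \<otimes> idt V \<I> = T"
  proof (rule iso_cancel_right[of "\<rho> C"])
    have "(\<epsilon> \<otimes> idt V \<I>) \<cdot> \<rho> C = \<rho> \<I> \<cdot> \<epsilon>"
      by (simp add: rho_natural)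
    also have "\<dots> = T \<cdot> \<rho> C"
      unfolding rho_semiunit[OF I] by (simp add: \<epsilon>_def)
    finally show "(\<epsilon> \<otimes> idt V \<I>) \<cdot> \<rho> C = T \<cdot> \<rho> C" .
  qed simp_all
qed

lemma inj_on_left_comonad_of:
  assumes I: "firm V \<I>" and C: "firm V C"
  shows "inj_on (left_comonad_of V C) (semicomonoid_structures V C)"
proof (rule inj_onI, simp only: split_paired_all prod.inject)
  note [simp] = firmD[OF I] firmD[OF C]
  fix \<Delta> \<epsilon> \<Delta>' \<epsilon>'
  assume \<Delta>\<epsilon>: "(\<Delta>, \<epsilon>) \<in> semicomonoid_structures V C"
    and \<Delta>\<epsilon>': "(\<Delta>', \<epsilon>') \<in> semicomonoid_structures V C"
  note homs = semicomonoid_homs(1)[OF \<Delta>\<epsilon>] semicomonoid_homs(1)[OF \<Delta>\<epsilon>']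
    semicomonoid_homs(2)[OF \<Delta>\<epsilon>] semicomonoid_homs(2)[OF \<Delta>\<epsilon>']
  have [simp]: "\<Delta> \<in> ar V" "src V \<Delta> = C" "tgt V \<Delta> = C \<bullet> C"
      "\<Delta>' \<in> ar V" "src V \<Delta>' = C" "tgt V \<Delta>' = C \<bullet> C"
    using homs unfolding hom_def by blast+
  assume "left_comonad_of V C (\<Delta>, \<epsilon>) = left_comonad_of V C (\<Delta>', \<epsilon>')"
  then have "(\<lambda>X \<in> ob V. \<gamma> C C X \<cdot> (\<Delta> \<otimes> idt V X)) = (\<lambda>X \<in> ob V. \<gamma> C C X \<cdot> (\<Delta>' \<otimes> idt V X))"
    and "(\<lambda>X \<in> ob V. \<epsilon> \<otimes> idt V X) = (\<lambda>X \<in> ob V. \<epsilon>' \<otimes> idt V X)"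
    unfolding left_comonad_of_def prod.case prod.inject by blast+
  from this[THEN fun_cong, of \<I>]
  have at: "\<gamma> C C \<I> \<cdot> (\<Delta> \<otimes> idt V \<I>) = \<gamma> C C \<I> \<cdot> (\<Delta>' \<otimes> idt V \<I>)"
    and at': "\<epsilon> \<otimes> idt V \<I> = \<epsilon>' \<otimes> idt V \<I>"
    by (simp_all only: restrict_apply' semiunit_ob)
  have "\<Delta> \<otimes> idt V \<I> = \<Delta>' \<otimes> idt V \<I>"
    by (rule iso_cancel_left[of "\<gamma> C C \<I>", OF _ at]) simp_all
  then have "\<Delta> = \<Delta>'"
    using tensor_semiunit_cancel[of "C \<bullet> C", OF _ homs(1,2)] is_iso_rho_tensor[OF _ C] by simp
  moreover have "\<epsilon> = \<epsilon>'"
    using tensor_semiunit_cancel[of \<I>, OF _ homs(3,4)] at' by simp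
  ultimately show "\<Delta> = \<Delta>' \<and> \<epsilon> = \<epsilon>'" ..
qed

lemma bij_betw_left_comonad_of:
  assumes "infinite (UNIV :: 'u set)" "locally_small TYPE('u) V"
    and I: "firm V \<I>" and C: "firm V C"
    and "regular_generator V \<I>" "preserves_colimits TYPE('u) V V (tensor_left V C)"
  shows "bij_betw (left_comonad_of V C) (semicomonoid_structures V C)
    (J_comonad_structures V (tensor_left V \<I>) (tensor_left V C) \<omega>)"
    (is "bij_betw ?f ?S ?J")
proof (rule bij_betw_imageI[OF inj_on_left_comonad_of[OF I C]], intro equalityI subsetI)
  note [simp] = firmD[OF I] firmD[OF C]
  fix p assume "p \<in> ?f ` ?S"
  then obtain \<Delta> \<epsilon> where "p = ?f (\<Delta>, \<epsilon>)" "(\<Delta>, \<epsilon>) \<in> ?S" by auto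
  then show "p \<in> ?J"
    using left_comonad_of_iff[OF I C semicomonoid_homs] by blast
next
  note [simp] = firmD[OF I] firmD[OF C]
  fix p assume p: "p \<in> ?J"
  obtain D T where DT: "p = (D, T)" by (cases p)
  have ext: "D \<in> extensional (ob V)" "T \<in> extensional (ob V)"
    and nat: "nat_trans V V (tensor_left V C) (comp_functor (tensor_left V C) (tensor_left V C)) D"
      "nat_trans V V (tensor_left V C) (tensor_left V \<I>) T"
    using p by (auto simp: DT J_comonad_structures_def is_J_comonad_def)
  have "D \<I> \<in> hom V (C \<bullet> \<I>) (C \<bullet> (C \<bullet> \<I>))" "T \<I> \<in> hom V (C \<bullet> \<I>) (\<I> \<bullet> \<I>)"
    using nat_transD(1)[OF nat(1), of \<I>] nat_transD(1)[OF nat(2), of \<I>]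
    by (simp_all add: tensor_left_def comp_functor_def)
  then obtain \<Delta> \<epsilon> where \<Delta>: "\<Delta> \<in> hom V C (C \<bullet> C)" and \<epsilon>: "\<epsilon> \<in> hom V C \<I>"
    and at: "\<gamma> C C \<I> \<cdot> (\<Delta> \<otimes> idt V \<I>) = D \<I>" "\<epsilon> \<otimes> idt V \<I> = T \<I>"
    using left_families_from_semiunit[OF I C] by blast
  note agree = nat_trans_eq_if_eq_at_generator[OF assms(1) category_axioms category_axioms
      is_functor_tensor_left[OF firmD(1)[OF C]] assms(2,6,5)]
  have "(\<lambda>X \<in> ob V. \<gamma> C C X \<cdot> (\<Delta> \<otimes> idt V X)) X = D X" if "X \<in> ob V" for X
    using agree[OF nat_trans_left_comultiplication[OF firmD(1)[OF C] \<Delta>] nat(1)] at(1) that by simp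
  moreover have "(\<lambda>X \<in> ob V. \<epsilon> \<otimes> idt V X) X = T X" if "X \<in> ob V" for X
    using agree[OF nat_trans_left_counit[OF firmD(1)[OF C] \<epsilon>] nat(2)] at(2) that by simp
  ultimately have "p = ?f (\<Delta>, \<epsilon>)"
    using ext unfolding DT left_comonad_of_def
    by (auto intro!: extensionalityI[of _ "ob V"])
  moreover have "(\<Delta>, \<epsilon>) \<in> ?S"
    using left_comonad_of_iff[OF I C \<Delta> \<epsilon>] p calculation by simp
  ultimately show "p \<in> ?f ` ?S" by blast
qed

end


section \<open>Comonads on the functor \<open>- \<bullet> C\<close>\<close>

text \<open>
  The same category with the reversed tensor product. The roles of \<open>\<omega>\<close> and \<open>\<rho>\<close> are exchanged, so
  that the functor \<open>- \<bullet> C\<close> becomes tensoring on the left.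
\<close>

definition mirror :: "('o, 'a, 'm) semiunital_cat_scheme \<Rightarrow> ('o, 'a, 'm) semiunital_cat_scheme" where
  "mirror V = V\<lparr>tensor_ob := (\<lambda>X Y. Y \<bullet>\<^bsub>V\<^esub> X), tensor_ar := (\<lambda>f g. g \<otimes>\<^bsub>V\<^esub> f),
     assoc := (\<lambda>X Y Z. inv_ar V (\<gamma>\<^bsub>V\<^esub> Z Y X)), omega := \<rho>\<^bsub>V\<^esub>, ell := \<wp>\<^bsub>V\<^esub>\<rparr>"

lemma mirror_simps [simp]:
  "ob (mirror V) = ob V" "ar (mirror V) = ar V" "src (mirror V) = src V" "tgt (mirror V) = tgt V"
  "idt (mirror V) = idt V" "cmp (mirror V) = cmp V"
  "tensor_ob (mirror V) X Y = Y \<bullet>\<^bsub>V\<^esub> X" "tensor_ar (mirror V) f g = g \<otimes>\<^bsub>V\<^esub> f"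
  "assoc (mirror V) X Y Z = inv_ar V (\<gamma>\<^bsub>V\<^esub> Z Y X)" "semiunit (mirror V) = \<I>\<^bsub>V\<^esub>"
  "omega (mirror V) = \<rho>\<^bsub>V\<^esub>" "ell (mirror V) = \<wp>\<^bsub>V\<^esub>"
  by (simp_all add: mirror_def)

lemma mirror_category_notions [simp]:
  "hom (mirror V) = hom V" "inverse_arrows (mirror V) = inverse_arrows V"
  "is_iso (mirror V) = is_iso V" "inv_ar (mirror V) = inv_ar V"
  by (simp_all add: fun_eq_iff hom_def inverse_arrows_def is_iso_def inv_ar_def)

lemma mirror_nat_trans [simp]: "nat_trans (mirror V) (mirror V) = nat_trans V V"
  by (simp add: fun_eq_iff nat_trans_def)

lemma mirror_is_functor [simp]: "is_functor (mirror V) (mirror V) = is_functor V V"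
  by (simp add: fun_eq_iff is_functor_def)

lemma mirror_tensor_left [simp]: "tensor_left (mirror V) X = tensor_right V X"
  by (simp add: tensor_left_def tensor_right_def)

lemma mirror_tensor_right [simp]: "tensor_right (mirror V) X = tensor_left V X"
  by (simp add: tensor_left_def tensor_right_def)

lemma mirror_J_comonad_structures [simp]:
  "J_comonad_structures (mirror V) J F w = J_comonad_structures V J F w"
  by (simp add: J_comonad_structures_def is_J_comonad_def)

lemma mirror_locally_small: "locally_small U (mirror V) = locally_small U V"
  by (simp add: locally_small_def)

lemma mirror_is_colimit [simp]:
  "is_colimit J (mirror V) = is_colimit J V" "is_functor J (mirror V) = is_functor J V"
  by (simp_all add: fun_eq_iff is_colimit_def is_cocone_def is_functor_def)

lemma mirror_regular_generator: "regular_generator (mirror V) G = regular_generator V G"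
  by (simp add: regular_generator_def is_coproduct_def regular_epi_def is_coequalizer_def)

lemma mirror_preserves_colimits:
  "preserves_colimits U (mirror V) (mirror V) F = preserves_colimits U V V F"
  by (simp add: preserves_colimits_def)

context semiunital_semimonoidal
begin

lemma rho_nat: "nat_trans V V id_functor (tensor_right V \<I>) \<rho>"
  by (simp add: nat_trans_def id_functor_def tensor_right_def hom_def rho_natural)

lemma wp_nat: "nat_trans V V (tensor_right V \<I>) (tensor_left V \<I>) \<wp>"
  by (simp add: nat_trans_def tensor_left_def tensor_right_def hom_def wp_natural) (simp add: wp_def)

text \<open>
  The pentagon and the law for \<open>\<l>\<close> at a tensor product turn into the equations between the inverse
  arrows. The two laws for \<open>\<omega>\<close> at a tensor product turn into \<open>rho_tensor\<close> and its combination with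
  \<open>triangle\<close>.
\<close>

lemma semiunital_semimonoidal_mirror: "semiunital_semimonoidal (mirror V)"
proof -
  have category: "category (mirror V)"
    by unfold_locales (auto intro: src_ob tgt_ob idt_hom cmp_hom cmp_idt_left cmp_idt_right cmp_assoc)
  have assoc_nat: "inv_ar V (\<gamma> Z' Y' X') \<cdot> (h \<otimes> (g \<otimes> f)) = ((h \<otimes> g) \<otimes> f) \<cdot> inv_ar V (\<gamma> Z Y X)"
    if "f \<in> hom V X X'" "g \<in> hom V Y Y'" "h \<in> hom V Z Z'" for X X' Y Y' Z Z' f g h
  proof -
    have ends: "f \<in> ar V" "g \<in> ar V" "h \<in> ar V" "X = src V f" "Y = src V g" "Z = src V h"
        "X' = tgt V f" "Y' = tgt V g" "Z' = tgt V h"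
      using that by (auto simp: hom_def)
    have "inv_ar V (\<gamma> Z' Y' X') \<cdot> (h \<otimes> (g \<otimes> f)) =
        inv_ar V (\<gamma> Z' Y' X') \<cdot> (((h \<otimes> (g \<otimes> f)) \<cdot> \<gamma> Z Y X) \<cdot> inv_ar V (\<gamma> Z Y X))"
      using ends by (simp add: cmp_assoc_ar)
    also have "(h \<otimes> (g \<otimes> f)) \<cdot> \<gamma> Z Y X = \<gamma> Z' Y' X' \<cdot> ((h \<otimes> g) \<otimes> f)"
      using ends by (simp add: assoc_nat_ar)
    also have "inv_ar V (\<gamma> Z' Y' X') \<cdot> ((\<gamma> Z' Y' X' \<cdot> ((h \<otimes> g) \<otimes> f)) \<cdot> inv_ar V (\<gamma> Z Y X)) =
        ((h \<otimes> g) \<otimes> f) \<cdot> inv_ar V (\<gamma> Z Y X)"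
      using ends by (simp add: cmp_assoc_ar)
    finally show ?thesis .
  qed
  have pentagon: "inv_ar V (\<gamma> (Z \<bullet> Y) X W) \<cdot> inv_ar V (\<gamma> Z Y (X \<bullet> W)) =
      (inv_ar V (\<gamma> Z Y X) \<otimes> idt V W) \<cdot> inv_ar V (\<gamma> Z (Y \<bullet> X) W) \<cdot> (idt V Z \<otimes> inv_ar V (\<gamma> Y X W))"
    if [simp]: "W \<in> ob V" "X \<in> ob V" "Y \<in> ob V" "Z \<in> ob V" for W X Y Z
  proof -
    have "inv_ar V (\<gamma> (Z \<bullet> Y) X W) \<cdot> inv_ar V (\<gamma> Z Y (X \<bullet> W)) =
        inv_ar V (\<gamma> Z Y (X \<bullet> W) \<cdot> \<gamma> (Z \<bullet> Y) X W)"
      by (simp add: inv_ar_of_cmp)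
    also have "\<dots> = inv_ar V ((idt V Z \<otimes> \<gamma> Y X W) \<cdot> \<gamma> Z (Y \<bullet> X) W \<cdot> (\<gamma> Z Y X \<otimes> idt V W))"
      by (simp add: pentagon)
    also have "\<dots> = (inv_ar V (\<gamma> Z Y X) \<otimes> idt V W) \<cdot> inv_ar V (\<gamma> Z (Y \<bullet> X) W) \<cdot>
        (idt V Z \<otimes> inv_ar V (\<gamma> Y X W))"
      by (simp add: inv_ar_of_cmp is_iso_cmp inv_ar_tensor cmp_assoc_ar)
    finally show ?thesis .
  qed
  have ell_tensor: "inv_ar V (\<gamma> \<I> Y X) \<cdot> \<wp> (Y \<bullet> X) \<cdot> inv_ar V (\<gamma> Y X \<I>) =
      (\<wp> Y \<otimes> idt V X) \<cdot> inv_ar V (\<gamma> Y \<I> X) \<cdot> (idt V Y \<otimes> \<wp> X)"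
    if [simp]: "X \<in> ob V" "Y \<in> ob V" for X Y
  proof -
    have "inv_ar V (\<gamma> \<I> Y X) \<cdot> \<wp> (Y \<bullet> X) \<cdot> inv_ar V (\<gamma> Y X \<I>) =
        inv_ar V (\<gamma> Y X \<I> \<cdot> \<l> (Y \<bullet> X) \<cdot> \<gamma> \<I> Y X)"
      by (simp add: inv_ar_of_cmp is_iso_cmp cmp_assoc_ar wp_def)
    also have "\<dots> = inv_ar V ((idt V Y \<otimes> \<l> X) \<cdot> \<gamma> Y \<I> X \<cdot> (\<l> Y \<otimes> idt V X))"
      by (simp add: ell_tensor)
    also have "\<dots> = (\<wp> Y \<otimes> idt V X) \<cdot> inv_ar V (\<gamma> Y \<I> X) \<cdot> (idt V Y \<otimes> \<wp> X)"
      by (simp add: inv_ar_of_cmp is_iso_cmp inv_ar_tensor cmp_assoc_ar wp_def)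
    finally show ?thesis .
  qed
  have rho_left: "\<rho> (Y \<bullet> X) = inv_ar V (\<gamma> Y X \<I>) \<cdot> (idt V Y \<otimes> \<rho> X)"
    if "X \<in> ob V" "Y \<in> ob V" for X Y
    using that by (simp add: rho_tensor[symmetric])
  have rho_right: "\<rho> (Y \<bullet> X) =
      inv_ar V (\<gamma> Y X \<I>) \<cdot> (idt V Y \<otimes> \<l> X) \<cdot> \<gamma> Y \<I> X \<cdot> (\<rho> Y \<otimes> idt V X)"
    if "X \<in> ob V" "Y \<in> ob V" for X Y
    using that by (simp add: rho_left triangle interchange) (simp add: rho_def)
  interpret mirror: category "mirror V" by fact
  show ?thesis
  proof unfold_locales
    show "nat_trans (mirror V) (mirror V) id_functor (tensor_left (mirror V) \<I>\<^bsub>mirror V\<^esub>)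
        \<omega>\<^bsub>mirror V\<^esub>"
      using rho_nat by simp
    show "nat_trans (mirror V) (mirror V) (tensor_left (mirror V) \<I>\<^bsub>mirror V\<^esub>)
        (tensor_right (mirror V) \<I>\<^bsub>mirror V\<^esub>) \<l>\<^bsub>mirror V\<^esub>"
      using wp_nat by simp
    show "\<l>\<^bsub>mirror V\<^esub> \<I>\<^bsub>mirror V\<^esub> = \<wp>\<^bsub>mirror V\<^esub> \<I>\<^bsub>mirror V\<^esub>"
      by (simp add: wp_def[of "mirror V"]) (simp add: wp_def ell_semiunit[unfolded wp_def, symmetric])
  qed (simp_all add: tensor_hom tensor_cmp assoc_nat pentagon ell_tensor rho_left[symmetric]
      wp_def[of "mirror V"], simp_all add: hom_def wp_def, rule rho_right)
qed

lemma semicomonoid_structures_mirror: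
  assumes C: "C \<in> ob V"
  shows "semicomonoid_structures (mirror V) C = semicomonoid_structures V C"
proof -
  note [simp] = C
  have "is_semicomonoid (mirror V) C \<Delta> \<epsilon> \<longleftrightarrow> is_semicomonoid V C \<Delta> \<epsilon>" for \<Delta> \<epsilon>
  proof (cases "\<Delta> \<in> hom V C (C \<bullet> C)")
    case True
    then have [simp]: "\<Delta> \<in> ar V" "src V \<Delta> = C" "tgt V \<Delta> = C \<bullet> C"
      by (auto simp: hom_def)
    have "\<gamma> C C C \<cdot> (\<Delta> \<otimes> idt V C) \<cdot> \<Delta> = (idt V C \<otimes> \<Delta>) \<cdot> \<Delta> \<longleftrightarrow>
        \<gamma> C C C \<cdot> (\<Delta> \<otimes> idt V C) \<cdot> \<Delta> = \<gamma> C C C \<cdot> inv_ar V (\<gamma> C C C) \<cdot> (idt V C \<otimes> \<Delta>) \<cdot> \<Delta>"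
      by simp
    also have "\<dots> \<longleftrightarrow> (\<Delta> \<otimes> idt V C) \<cdot> \<Delta> = inv_ar V (\<gamma> C C C) \<cdot> (idt V C \<otimes> \<Delta>) \<cdot> \<Delta>"
      by (rule iso_cancel_left_iff) simp_all
    finally have coassoc: "\<gamma> C C C \<cdot> (\<Delta> \<otimes> idt V C) \<cdot> \<Delta> = (idt V C \<otimes> \<Delta>) \<cdot> \<Delta> \<longleftrightarrow>
        inv_ar V (\<gamma> C C C) \<cdot> (idt V C \<otimes> \<Delta>) \<cdot> \<Delta> = (\<Delta> \<otimes> idt V C) \<cdot> \<Delta>"
      by (simp only: eq_commute[of "(\<Delta> \<otimes> idt V C) \<cdot> \<Delta>"])
    have wp_rho: "\<wp> C \<cdot> \<rho> C = \<omega> C"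
      by (simp add: wp_def rho_def)
    show ?thesis
      unfolding is_semicomonoid_def mirror_simps mirror_category_notions coassoc wp_rho rho_def[symmetric]
      by blast
  next
    case False
    then show ?thesis by (simp add: is_semicomonoid_def)
  qed
  then show ?thesis by (simp add: semicomonoid_structures_def)
qed

end

lemma is_J_comonad_transport:
  assumes "category V" and J': "is_functor V V J'" and \<alpha>: "nat_trans V V J J' \<alpha>"
    and w': "\<And>X. X \<in> ob V \<Longrightarrow> w' X = \<alpha> X \<cdot>\<^bsub>V\<^esub> w X"
    and comonad: "is_J_comonad V J F \<Delta> w \<theta>"
  shows "is_J_comonad V J' F \<Delta> w' (\<lambda>X \<in> ob V. \<alpha> X \<cdot>\<^bsub>V\<^esub> \<theta> X)"
proof -
  interpret category V by fact
  have F: "is_functor V V F" and \<Delta>: "nat_trans V V F (comp_functor F F) \<Delta>"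
    and w: "nat_trans V V id_functor J w" and \<theta>: "nat_trans V V F J \<theta>"
    and J: "is_functor V V J"
    using comonad by (simp_all add: is_J_comonad_def)
  have nat: "nat_trans V V G J' (\<lambda>X \<in> ob V. \<alpha> X \<cdot>\<^bsub>V\<^esub> \<tau> X)"
    if \<tau>: "nat_trans V V G J \<tau>" and G: "is_functor V V G" for G \<tau>
    unfolding nat_trans_def
  proof (intro conjI ballI)
    fix X assume "X \<in> ob V"
    then show "(\<lambda>X \<in> ob V. \<alpha> X \<cdot>\<^bsub>V\<^esub> \<tau> X) X \<in> hom V (fo G X) (fo J' X)"
      using cmp_hom[OF nat_transD(1)[OF \<tau>] nat_transD(1)[OF \<alpha>]] by simp
  next
    fix f assume f: "f \<in> ar V"
    define X Y where "X = src V f" and "Y = tgt V f"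
    have X: "X \<in> ob V" and Y: "Y \<in> ob V" and fXY: "f \<in> hom V X Y"
      using f by (simp_all add: X_def Y_def hom_def)
    note homs = nat_transD(1)[OF \<alpha> X] nat_transD(1)[OF \<alpha> Y] nat_transD(1)[OF \<tau> X]
      nat_transD(1)[OF \<tau> Y] is_functorD(2)[OF G fXY] is_functorD(2)[OF J fXY] is_functorD(2)[OF J' fXY]
    have "(\<alpha> Y \<cdot>\<^bsub>V\<^esub> \<tau> Y) \<cdot>\<^bsub>V\<^esub> fa G f = \<alpha> Y \<cdot>\<^bsub>V\<^esub> (\<tau> Y \<cdot>\<^bsub>V\<^esub> fa G f)"
      using homs(5,4,2) by (rule cmp_assoc)
    also have "\<dots> = \<alpha> Y \<cdot>\<^bsub>V\<^esub> (fa J f \<cdot>\<^bsub>V\<^esub> \<tau> X)"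
      by (simp only: nat_transD(2)[OF \<tau> fXY])
    also have "\<dots> = (\<alpha> Y \<cdot>\<^bsub>V\<^esub> fa J f) \<cdot>\<^bsub>V\<^esub> \<tau> X"
      using homs(3,6,2) by (rule cmp_assoc[symmetric])
    also have "\<dots> = (fa J' f \<cdot>\<^bsub>V\<^esub> \<alpha> X) \<cdot>\<^bsub>V\<^esub> \<tau> X"
      by (simp only: nat_transD(2)[OF \<alpha> fXY])
    also have "\<dots> = fa J' f \<cdot>\<^bsub>V\<^esub> (\<alpha> X \<cdot>\<^bsub>V\<^esub> \<tau> X)"
      using homs(3,1,7) by (rule cmp_assoc)
    finally show "(\<lambda>X \<in> ob V. \<alpha> X \<cdot>\<^bsub>V\<^esub> \<tau> X) (tgt V f) \<cdot>\<^bsub>V\<^esub> fa G f =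
        fa J' f \<cdot>\<^bsub>V\<^esub> (\<lambda>X \<in> ob V. \<alpha> X \<cdot>\<^bsub>V\<^esub> \<tau> X) (src V f)"
      using X Y by (simp add: X_def Y_def)
  qed
  have "is_functor V V id_functor"
    by (simp add: is_functor_def id_functor_def hom_def)
  from nat[OF w this] have w'_nat: "nat_trans V V id_functor J' w'"
    using w' by (simp add: nat_trans_def)
  have laws: "(\<alpha> (fo F X) \<cdot>\<^bsub>V\<^esub> \<theta> (fo F X)) \<cdot>\<^bsub>V\<^esub> \<Delta> X = w' (fo F X)"
    "fa F (\<alpha> X \<cdot>\<^bsub>V\<^esub> \<theta> X) \<cdot>\<^bsub>V\<^esub> \<Delta> X = fa F (w' X)" if X: "X \<in> ob V" for X
  proof -
    have FX: "fo F X \<in> ob V" by (rule is_functorD(1)[OF F X])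
    have \<Delta>X: "\<Delta> X \<in> hom V (fo F X) (fo F (fo F X))"
      using nat_transD(1)[OF \<Delta> X] by (simp add: comp_functor_def)
    have wX: "w X \<in> hom V X (fo J X)"
      using nat_transD(1)[OF w X] by (simp add: id_functor_def)
    note \<theta>X = nat_transD(1)[OF \<theta> X] and \<alpha>X = nat_transD(1)[OF \<alpha> X]
    have "(\<alpha> (fo F X) \<cdot>\<^bsub>V\<^esub> \<theta> (fo F X)) \<cdot>\<^bsub>V\<^esub> \<Delta> X = \<alpha> (fo F X) \<cdot>\<^bsub>V\<^esub> (\<theta> (fo F X) \<cdot>\<^bsub>V\<^esub> \<Delta> X)"
      using \<Delta>X nat_transD(1)[OF \<theta> FX] nat_transD(1)[OF \<alpha> FX] by (rule cmp_assoc)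
    also have "\<theta> (fo F X) \<cdot>\<^bsub>V\<^esub> \<Delta> X = w (fo F X)"
      using comonad X by (simp add: is_J_comonad_def)
    finally show "(\<alpha> (fo F X) \<cdot>\<^bsub>V\<^esub> \<theta> (fo F X)) \<cdot>\<^bsub>V\<^esub> \<Delta> X = w' (fo F X)"
      by (simp only: w'[OF FX])
    have "fa F (\<alpha> X \<cdot>\<^bsub>V\<^esub> \<theta> X) \<cdot>\<^bsub>V\<^esub> \<Delta> X = (fa F (\<alpha> X) \<cdot>\<^bsub>V\<^esub> fa F (\<theta> X)) \<cdot>\<^bsub>V\<^esub> \<Delta> X"
      by (simp only: is_functorD(4)[OF F \<theta>X \<alpha>X])
    also have "\<dots> = fa F (\<alpha> X) \<cdot>\<^bsub>V\<^esub> (fa F (\<theta> X) \<cdot>\<^bsub>V\<^esub> \<Delta> X)"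
      using \<Delta>X is_functorD(2)[OF F \<theta>X] is_functorD(2)[OF F \<alpha>X] by (rule cmp_assoc)
    also have "fa F (\<theta> X) \<cdot>\<^bsub>V\<^esub> \<Delta> X = fa F (w X)"
      using comonad X by (simp add: is_J_comonad_def)
    also have "fa F (\<alpha> X) \<cdot>\<^bsub>V\<^esub> fa F (w X) = fa F (w' X)"
      by (simp only: is_functorD(4)[OF F wX \<alpha>X] w'[OF X])
    finally show "fa F (\<alpha> X \<cdot>\<^bsub>V\<^esub> \<theta> X) \<cdot>\<^bsub>V\<^esub> \<Delta> X = fa F (w' X)" .
  qed
  have "\<Delta> (fo F X) \<cdot>\<^bsub>V\<^esub> \<Delta> X = fa F (\<Delta> X) \<cdot>\<^bsub>V\<^esub> \<Delta> X" if "X \<in> ob V" for X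
    using comonad that by (simp add: is_J_comonad_def)
  then show ?thesis
    using F \<Delta> J' w'_nat nat[OF \<theta> F] laws is_functorD(1)[OF F]
    by (simp add: is_J_comonad_def)
qed

text \<open>
  This identifies comonads relative to \<open>- \<bullet> \<I>\<close>, which reversal of the tensor product produces, with
  comonads relative to \<open>\<I> \<bullet> -\<close>.
\<close>

lemma bij_betw_J_comonad_transport:
  assumes "category V" "is_functor V V J" "is_functor V V J'"
    and "nat_trans V V J J' \<alpha>" "nat_trans V V J' J \<beta>"
    and w: "\<And>X. X \<in> ob V \<Longrightarrow> w X = \<beta> X \<cdot>\<^bsub>V\<^esub> w' X" "\<And>X. X \<in> ob V \<Longrightarrow> w' X = \<alpha> X \<cdot>\<^bsub>V\<^esub> w X"
    and inverse: "\<And>X. X \<in> ob V \<Longrightarrow> \<beta> X \<cdot>\<^bsub>V\<^esub> \<alpha> X = idt V (fo J X)"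
      "\<And>X. X \<in> ob V \<Longrightarrow> \<alpha> X \<cdot>\<^bsub>V\<^esub> \<beta> X = idt V (fo J' X)"
  shows "bij_betw (\<lambda>(\<Delta>, \<theta>). (\<Delta>, \<lambda>X \<in> ob V. \<alpha> X \<cdot>\<^bsub>V\<^esub> \<theta> X))
    (J_comonad_structures V J F w) (J_comonad_structures V J' F w')"
proof -
  interpret category V by fact
  have cancel: "(\<lambda>X \<in> ob V. \<tau> X \<cdot>\<^bsub>V\<^esub> (\<lambda>X \<in> ob V. \<sigma> X \<cdot>\<^bsub>V\<^esub> \<theta> X) X) = \<theta>"
    if "is_J_comonad V K F \<Delta> u \<theta>" "\<theta> \<in> extensional (ob V)" "nat_trans V V K K' \<sigma>"
      "nat_trans V V K' K \<tau>" "\<And>X. X \<in> ob V \<Longrightarrow> \<tau> X \<cdot>\<^bsub>V\<^esub> \<sigma> X = idt V (fo K X)"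
    for K K' \<sigma> \<tau> u \<Delta> \<theta>
  proof (rule extensionalityI[of _ "ob V"])
    fix X assume X: "X \<in> ob V"
    have \<theta>: "nat_trans V V F K \<theta>"
      using that(1) by (simp add: is_J_comonad_def)
    have "\<tau> X \<cdot>\<^bsub>V\<^esub> (\<sigma> X \<cdot>\<^bsub>V\<^esub> \<theta> X) = (\<tau> X \<cdot>\<^bsub>V\<^esub> \<sigma> X) \<cdot>\<^bsub>V\<^esub> \<theta> X"
      using nat_transD(1)[OF \<theta> X] nat_transD(1)[OF that(3) X] nat_transD(1)[OF that(4) X]
      by (rule cmp_assoc[symmetric])
    also have "\<dots> = \<theta> X"
      unfolding that(5)[OF X] using nat_transD(1)[OF \<theta> X] by (rule cmp_idt_left)
    finally show "(\<lambda>X \<in> ob V. \<tau> X \<cdot>\<^bsub>V\<^esub> (\<lambda>X \<in> ob V. \<sigma> X \<cdot>\<^bsub>V\<^esub> \<theta> X) X) X = \<theta> X"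
      using X by simp
  qed (use that(2) in simp_all)
  note forth = is_J_comonad_transport[OF assms(1,3,4) w(2)]
    and forth_inverse = is_J_comonad_transport[OF assms(1,2,5) w(1)]
  show ?thesis
  proof (rule bij_betw_byWitness[where f' = "\<lambda>(\<Delta>, \<theta>). (\<Delta>, \<lambda>X \<in> ob V. \<beta> X \<cdot>\<^bsub>V\<^esub> \<theta> X)"])
    show "\<forall>p \<in> J_comonad_structures V J F w. (\<lambda>(\<Delta>, \<theta>). (\<Delta>, \<lambda>X \<in> ob V. \<beta> X \<cdot>\<^bsub>V\<^esub> \<theta> X))
        ((\<lambda>(\<Delta>, \<theta>). (\<Delta>, \<lambda>X \<in> ob V. \<alpha> X \<cdot>\<^bsub>V\<^esub> \<theta> X)) p) = p"
      using cancel[OF _ _ assms(4,5) inverse(1)] by (auto simp: J_comonad_structures_def)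
    show "\<forall>p \<in> J_comonad_structures V J' F w'. (\<lambda>(\<Delta>, \<theta>). (\<Delta>, \<lambda>X \<in> ob V. \<alpha> X \<cdot>\<^bsub>V\<^esub> \<theta> X))
        ((\<lambda>(\<Delta>, \<theta>). (\<Delta>, \<lambda>X \<in> ob V. \<beta> X \<cdot>\<^bsub>V\<^esub> \<theta> X)) p) = p"
      using cancel[OF _ _ assms(5,4) inverse(2)] by (auto simp: J_comonad_structures_def)
    show "(\<lambda>(\<Delta>, \<theta>). (\<Delta>, \<lambda>X \<in> ob V. \<alpha> X \<cdot>\<^bsub>V\<^esub> \<theta> X)) ` J_comonad_structures V J F w
        \<subseteq> J_comonad_structures V J' F w'"
      using forth by (auto simp: J_comonad_structures_def)
    show "(\<lambda>(\<Delta>, \<theta>). (\<Delta>, \<lambda>X \<in> ob V. \<beta> X \<cdot>\<^bsub>V\<^esub> \<theta> X)) ` J_comonad_structures V J' F w'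
        \<subseteq> J_comonad_structures V J F w"
      using forth_inverse by (auto simp: J_comonad_structures_def)
  qed
qed

lemma (in semiunital_semimonoidal) bij_betw_right_comonad_of:
  assumes "infinite (UNIV :: 'u set)" "locally_small TYPE('u) V"
    and I: "firm V \<I>" and C: "firm V C"
    and "regular_generator V \<I>" "preserves_colimits TYPE('u) V V (tensor_right V C)"
  shows "bij_betw (right_comonad_of V C) (semicomonoid_structures V C)
    (J_comonad_structures V (tensor_left V \<I>) (tensor_right V C) \<omega>)"
proof -
  interpret mirror: semiunital_semimonoidal "mirror V"
    by (rule semiunital_semimonoidal_mirror)
  have firm: "firm (mirror V) X" if "firm V X" for X
    using firmD[OF that] by (simp add: firm_def)
  have left: "bij_betw (left_comonad_of (mirror V) C) (semicomonoid_structures V C)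
      (J_comonad_structures V (tensor_right V \<I>) (tensor_right V C) \<rho>)"
    using mirror.bij_betw_left_comonad_of[of C, where ?'u = 'u] assms firm[OF I] firm[OF C] firmD(1)[OF C]
    by (simp add: mirror_locally_small mirror_regular_generator mirror_preserves_colimits
        semicomonoid_structures_mirror)
  have transport: "bij_betw (\<lambda>(\<Delta>, \<theta>). (\<Delta>, \<lambda>X \<in> ob V. \<wp> X \<cdot> \<theta> X))
      (J_comonad_structures V (tensor_right V \<I>) (tensor_right V C) \<rho>)
      (J_comonad_structures V (tensor_left V \<I>) (tensor_right V C) \<omega>)"
    by (rule bij_betw_J_comonad_transport[where \<beta> = \<l>])
      (simp_all add: category_axioms is_functor_tensor_left is_functor_tensor_right wp_nat ell_nat,
       simp_all add: wp_def rho_def tensor_left_def tensor_right_def)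
  have "bij_betw ((\<lambda>(\<Delta>, \<theta>). (\<Delta>, \<lambda>X \<in> ob V. \<wp> X \<cdot> \<theta> X)) \<circ> left_comonad_of (mirror V) C)
      (semicomonoid_structures V C)
      (J_comonad_structures V (tensor_left V \<I>) (tensor_right V C) \<omega>)"
    using left transport by (rule bij_betw_trans)
  moreover have "(\<lambda>(\<Delta>, \<theta>). (\<Delta>, \<lambda>X \<in> ob V. \<wp> X \<cdot> \<theta> X)) \<circ> left_comonad_of (mirror V) C =
      right_comonad_of V C"
    by (auto simp: fun_eq_iff left_comonad_of_def right_comonad_of_def)
  ultimately show ?thesis by simp
qed

theorem theorem4p17:
  fixes V :: "('o, 'a) semiunital_cat" and C :: 'o
  assumes "infinite (UNIV :: 'u set)"
    and "semiunital_semimonoidal V"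
    and "locally_small TYPE('u) V"
    and "cocomplete TYPE('u) V"
    and "firm V \<I>\<^bsub>V\<^esub>"
    and "firm V C"
    and "regular_generator V \<I>\<^bsub>V\<^esub>"
    and "preserves_colimits TYPE('u) V V (tensor_left V C)"
    and "preserves_colimits TYPE('u) V V (tensor_right V C)"
  shows "bij_betw (right_comonad_of V C)
           (semicomonoid_structures V C)
           (J_comonad_structures V (tensor_left V \<I>\<^bsub>V\<^esub>) (tensor_right V C) \<omega>\<^bsub>V\<^esub>) \<and>
         bij_betw (left_comonad_of V C)
           (semicomonoid_structures V C)
           (J_comonad_structures V (tensor_left V \<I>\<^bsub>V\<^esub>) (tensor_left V C) \<omega>\<^bsub>V\<^esub>)"
proof -
  interpret semiunital_semimonoidal V by fact
  show ?thesis
    using bij_betw_right_comonad_of[OF assms(1,3,5,6,7,9)]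
      bij_betw_left_comonad_of[OF assms(1,3,5,6,7,8)] by blast
qed

end
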